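(* Let $M$ be a finite regular left duo monoid with left regular band of idempotents $B$ and let $K$ be a field. Fix for each $X\in\Lambda(B)$ an element $e_X\in B$ with $X=Be_X$, and define elements $\eta_X\in KB$ recursively by $\eta_X=e_X-\sum_{Y<X}e_X\eta_Y$. For each $X\in \Lambda(B)$, choose a complete set of orthogonal primitive idempotents $\theta_{X,1},\ldots,\theta_{X,k_X}$ of $KG_{e_X}\subseteq KM$, summing up to $e_X$. Then the elements $\gamma_{X,i}=\eta_X\theta_{X,i}\eta_X$ of $KM$ ($X\in\Lambda(B)$, $1\leq i\leq k_X$) form a complete set of orthogonal primitive idempotents of $KM$, and $KM\gamma_{X,i}$ is the projective cover of the simple $KG_{e_X}$-module $KG_{e_X}\theta_{X,i}/\operatorname{rad}(KG_{e_X})\theta_{X,i}$, inflated to $KM$.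
   Context: Modules are left modules. A monoid $M$ is regular if for each $m\in M$ there is $a\in M$ with $mam=m$; it is left duo if $mM\subseteq Mm$ for all $m\in M$. For a finite regular left duo monoid $M$, the set $B=E(M)$ of idempotents is a submonoid which is a left regular band (it satisfies $xyx=xy$). $\Lambda(B)=\{Be\mid e\in B\}$ is the set of principal left ideals of $B$, ordered by inclusion. For $e\in B$ one has $eM=eMe$, and $G_e$ denotes the group of units of the monoid $eMe$ (identity $e$). Inflation of a $KG_e$-module to $KM$ is along the surjective $K$-algebra homomorphism $\varphi_e\colon KM\to KG_e$ given on $m\in M$ by $\varphi_e(m)=em$ if $em\in G_e$ and $\varphi_e(m)=0$ otherwise. A complete set of orthogonal primitive idempotents of a ring is a finite set of pairwise orthogonal primitive idempotents with sum $1$. *)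

theory Defs
  imports "HOL-Algebra.Module" "HOL-Algebra.AbelCoset"
begin

section \<open>Left modules over a ring\<close>

text \<open>The library locale \<open>module\<close> requires a commutative ring of scalars; here the ring is
  arbitrary. The fields \<open>mult\<close> and \<open>one\<close> of the \<open>module\<close> record, as well as the values of all
  operations outside the carriers, are irrelevant throughout.\<close>

locale left_module = R?: ring R + V?: abelian_group V
  for R :: "('r, 'x) ring_scheme" (structure) and V :: "('r, 'v) module" (structure) +
  assumes smult_closed: "\<lbrakk>a \<in> carrier R; v \<in> carrier V\<rbrakk> \<Longrightarrow> a \<odot>\<^bsub>V\<^esub> v \<in> carrier V"
    and smult_l_distr: "\<lbrakk>a \<in> carrier R; b \<in> carrier R; v \<in> carrier V\<rbrakk> \<Longrightarrow>
          (a \<oplus>\<^bsub>R\<^esub> b) \<odot>\<^bsub>V\<^esub> v = a \<odot>\<^bsub>V\<^esub> v \<oplus>\<^bsub>V\<^esub> b \<odot>\<^bsub>V\<^esub> v"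
    and smult_r_distr: "\<lbrakk>a \<in> carrier R; v \<in> carrier V; w \<in> carrier V\<rbrakk> \<Longrightarrow>
          a \<odot>\<^bsub>V\<^esub> (v \<oplus>\<^bsub>V\<^esub> w) = a \<odot>\<^bsub>V\<^esub> v \<oplus>\<^bsub>V\<^esub> a \<odot>\<^bsub>V\<^esub> w"
    and smult_assoc: "\<lbrakk>a \<in> carrier R; b \<in> carrier R; v \<in> carrier V\<rbrakk> \<Longrightarrow>
          (a \<otimes>\<^bsub>R\<^esub> b) \<odot>\<^bsub>V\<^esub> v = a \<odot>\<^bsub>V\<^esub> (b \<odot>\<^bsub>V\<^esub> v)"
    and smult_one: "v \<in> carrier V \<Longrightarrow> \<one>\<^bsub>R\<^esub> \<odot>\<^bsub>V\<^esub> v = v"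

definition left_module_hom ::
    "('r, 'x) ring_scheme \<Rightarrow> ('r, 'v) module \<Rightarrow> ('r, 'w) module \<Rightarrow> ('v \<Rightarrow> 'w) set" where
  "left_module_hom R V W = {h. h \<in> carrier V \<rightarrow> carrier W \<and>
     (\<forall>v\<in>carrier V. \<forall>w\<in>carrier V. h (v \<oplus>\<^bsub>V\<^esub> w) = h v \<oplus>\<^bsub>W\<^esub> h w) \<and>
     (\<forall>a\<in>carrier R. \<forall>v\<in>carrier V. h (a \<odot>\<^bsub>V\<^esub> v) = a \<odot>\<^bsub>W\<^esub> h v)}"

definition simple_module :: "('r, 'x) ring_scheme \<Rightarrow> ('r, 'v) module \<Rightarrow> bool" where
  "simple_module R V \<longleftrightarrow> left_module R V \<and> carrier V \<noteq> {\<zero>\<^bsub>V\<^esub>} \<and>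
     (\<forall>N. submodule N R V \<longrightarrow> N = {\<zero>\<^bsub>V\<^esub>} \<or> N = carrier V)"

definition left_ideal_module :: "('r, 'x) ring_scheme \<Rightarrow> 'r set \<Rightarrow> ('r, 'r) module" where
  "left_ideal_module R I = \<lparr>carrier = I, monoid.mult = monoid.mult R,
     monoid.one = \<one>\<^bsub>R\<^esub>, ring.zero = \<zero>\<^bsub>R\<^esub>, ring.add = ring.add R, smult = monoid.mult R\<rparr>"

definition quotient_module :: "('r, 'v) module \<Rightarrow> 'v set \<Rightarrow> ('r, 'v set) module" where
  "quotient_module V N = \<lparr>carrier = a_rcosets\<^bsub>V\<^esub> N,
     monoid.mult = undefined, monoid.one = undefined, ring.zero = N, ring.add = set_add V,
     smult = (\<lambda>a C. \<Union>v\<in>C. N +>\<^bsub>V\<^esub> (a \<odot>\<^bsub>V\<^esub> v))\<rparr>"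

definition restrict_scalars :: "('r \<Rightarrow> 's) \<Rightarrow> ('s, 'v) module \<Rightarrow> ('r, 'v) module" where
  "restrict_scalars f V = \<lparr>carrier = carrier V, monoid.mult = monoid.mult V,
     monoid.one = monoid.one V, ring.zero = ring.zero V, ring.add = ring.add V, smult = (\<lambda>a v. f a \<odot>\<^bsub>V\<^esub> v)\<rparr>"

text \<open>HOL cannot quantify over types inside a formula, so the types of the test modules in the
  lifting property are parameters. A theorem concluding \<open>projective_module\<close> with type variables
  \<open>'a\<close>, \<open>'b\<close> not occurring elsewhere asserts the lifting property for test modules on
  arbitrary types.\<close>

definition projective_module ::
    "'a itself \<Rightarrow> 'b itself \<Rightarrow> ('r, 'x) ring_scheme \<Rightarrow> ('r, 'p) module \<Rightarrow> bool" where
  "projective_module _ _ R P \<longleftrightarrow> left_module R P \<and>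
     (\<forall>(V :: ('r, 'a) module) (W :: ('r, 'b) module).
        \<forall>g\<in>left_module_hom R V W. \<forall>h\<in>left_module_hom R P W.
          left_module R V \<longrightarrow> left_module R W \<longrightarrow> g ` carrier V = carrier W \<longrightarrow>
          (\<exists>h'\<in>left_module_hom R P V. \<forall>p\<in>carrier P. g (h' p) = h p))"

definition superfluous_submodule ::
    "('r, 'x) ring_scheme \<Rightarrow> ('r, 'v) module \<Rightarrow> 'v set \<Rightarrow> bool" where
  "superfluous_submodule R V N \<longleftrightarrow> submodule N R V \<and>
     (\<forall>L. submodule L R V \<and> N <+>\<^bsub>V\<^esub> L = carrier V \<longrightarrow> L = carrier V)"

definition projective_cover ::
    "'a itself \<Rightarrow> 'b itself \<Rightarrow> ('r, 'x) ring_scheme \<Rightarrow> ('r, 'p) module \<Rightarrow> ('r, 'v) module \<Rightarrow>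
      ('p \<Rightarrow> 'v) \<Rightarrow> bool" where
  "projective_cover A B R P V f \<longleftrightarrow> projective_module A B R P \<and> left_module R V \<and>
     f \<in> left_module_hom R P V \<and> f ` carrier P = carrier V \<and>
     superfluous_submodule R P {p \<in> carrier P. f p = \<zero>\<^bsub>V\<^esub>}"


section \<open>Left ideals, the Jacobson radical, and primitive idempotents\<close>

definition left_ideal :: "'r set \<Rightarrow> ('r, 'x) ring_scheme \<Rightarrow> bool" where
  "left_ideal I R \<longleftrightarrow> submodule I R (left_ideal_module R (carrier R))"

definition maximal_left_ideal :: "'r set \<Rightarrow> ('r, 'x) ring_scheme \<Rightarrow> bool" where
  "maximal_left_ideal I R \<longleftrightarrow> left_ideal I R \<and> I \<noteq> carrier R \<and>
     (\<forall>J. left_ideal J R \<and> I \<subseteq> J \<longrightarrow> J = I \<or> J = carrier R)"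

definition jacobson_radical :: "('r, 'x) ring_scheme \<Rightarrow> 'r set" where
  "jacobson_radical R = carrier R \<inter> \<Inter>{I. maximal_left_ideal I R}"

definition right_translate :: "('r, 'x) ring_scheme \<Rightarrow> 'r set \<Rightarrow> 'r \<Rightarrow> 'r set" where
  "right_translate R A x = (\<lambda>a. a \<otimes>\<^bsub>R\<^esub> x) ` A"

definition idempotent_element :: "('r, 'x) ring_scheme \<Rightarrow> 'r \<Rightarrow> bool" where
  "idempotent_element R p \<longleftrightarrow> p \<in> carrier R \<and> p \<otimes>\<^bsub>R\<^esub> p = p"

definition orthogonal_elements :: "('r, 'x) ring_scheme \<Rightarrow> 'r \<Rightarrow> 'r \<Rightarrow> bool" where
  "orthogonal_elements R p q \<longleftrightarrow> p \<otimes>\<^bsub>R\<^esub> q = \<zero>\<^bsub>R\<^esub> \<and> q \<otimes>\<^bsub>R\<^esub> p = \<zero>\<^bsub>R\<^esub>"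

definition primitive_idempotent :: "('r, 'x) ring_scheme \<Rightarrow> 'r \<Rightarrow> bool" where
  "primitive_idempotent R p \<longleftrightarrow> idempotent_element R p \<and> p \<noteq> \<zero>\<^bsub>R\<^esub> \<and>
     (\<forall>a b. idempotent_element R a \<and> idempotent_element R b \<and> orthogonal_elements R a b \<and>
        p = a \<oplus>\<^bsub>R\<^esub> b \<longrightarrow> a = \<zero>\<^bsub>R\<^esub> \<or> b = \<zero>\<^bsub>R\<^esub>)"

text \<open>The set is given as a family; orthogonality of nonzero idempotents at distinct indices
  forces the family to be injective.\<close>

definition complete_orthogonal_primitive ::
    "('r, 'x) ring_scheme \<Rightarrow> 'i set \<Rightarrow> ('i \<Rightarrow> 'r) \<Rightarrow> bool" where
  "complete_orthogonal_primitive R I p \<longleftrightarrow> finite I \<and>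
     (\<forall>i\<in>I. primitive_idempotent R (p i)) \<and>
     (\<forall>i\<in>I. \<forall>j\<in>I. i \<noteq> j \<longrightarrow> orthogonal_elements R (p i) (p j)) \<and>
     finsum R p I = \<one>\<^bsub>R\<^esub>"


section \<open>Finite monoids and their algebras\<close>

definition regular_monoid :: "'m::monoid_mult itself \<Rightarrow> bool" where
  "regular_monoid _ \<longleftrightarrow> (\<forall>m::'m. \<exists>a. m * a * m = m)"

definition left_duo_monoid :: "'m::monoid_mult itself \<Rightarrow> bool" where
  "left_duo_monoid _ \<longleftrightarrow> (\<forall>m::'m. {m * x |x. True} \<subseteq> {x * m |x. True})"

definition idempotents :: "'m::monoid_mult set" where
  "idempotents = {b. b * b = b}"

definition principal_left :: "'m::monoid_mult \<Rightarrow> 'm set" where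
  "principal_left e = {b * e |b. b \<in> idempotents}"

definition left_ideal_poset :: "'m::monoid_mult set set" where
  "left_ideal_poset = {principal_left e |e. e \<in> idempotents}"

definition corner :: "'m::monoid_mult \<Rightarrow> 'm set" where
  "corner e = {e * x * e |x. True}"

definition corner_units :: "'m::monoid_mult \<Rightarrow> 'm set" where
  "corner_units e = {g \<in> corner e. \<exists>h\<in>corner e. g * h = e \<and> h * g = e}"

text \<open>The function \<open>f\<close> stands for the formal sum of the \<open>f m\<close> times \<open>m\<close>.\<close>

definition basis_element :: "'m \<Rightarrow> 'm \<Rightarrow> 'k::zero_neq_one" where
  "basis_element a = (\<lambda>m. if m = a then 1 else 0)"

definition convolution ::
    "('m::{finite, monoid_mult} \<Rightarrow> 'k::field) \<Rightarrow> ('m \<Rightarrow> 'k) \<Rightarrow> 'm \<Rightarrow> 'k" where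
  "convolution f g = (\<lambda>m. \<Sum>(a, b)\<in>{(a, b). a * b = m}. f a * g b)"

definition monoid_algebra :: "('m::{finite, monoid_mult} \<Rightarrow> 'k::field) ring" where
  "monoid_algebra = \<lparr>carrier = UNIV, monoid.mult = convolution, monoid.one = basis_element 1,
     ring.zero = (\<lambda>m. 0), ring.add = (\<lambda>f g m. f m + g m)\<rparr>"

text \<open>As a subset of the monoid algebra; its identity is \<open>e\<close>, not \<open>1\<close>.\<close>

definition group_algebra_at ::
    "'m::{finite, monoid_mult} \<Rightarrow> ('m \<Rightarrow> 'k::field) ring" where
  "group_algebra_at e = monoid_algebra
     \<lparr>carrier := {f. \<forall>m. m \<notin> corner_units e \<longrightarrow> f m = 0}, monoid.one := basis_element e\<rparr>"

text \<open>The linear extension of the map sending a monoid element \<open>m\<close> to \<open>e * m\<close> if this is a unit of the corner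
  at \<open>e\<close>, and to \<open>0\<close> otherwise.\<close>

definition corner_projection ::
    "'m::{finite, monoid_mult} \<Rightarrow> ('m \<Rightarrow> 'k::field) \<Rightarrow> 'm \<Rightarrow> 'k" where
  "corner_projection e f =
     (\<lambda>g. \<Sum>m\<in>UNIV. f m * (if e * m \<in> corner_units e then basis_element (e * m) g else 0))"

function eta ::
    "('m::{finite, monoid_mult} set \<Rightarrow> 'm) \<Rightarrow> 'm set \<Rightarrow> 'm \<Rightarrow> 'k::field" where
  "eta e L = (\<lambda>m. basis_element (e L) m -
     (\<Sum>L'\<in>{L' \<in> left_ideal_poset. L' \<subset> L}. convolution (basis_element (e L)) (eta e L') m))"
  by pat_completeness auto
termination
  by (relation "measure (\<lambda>(e, L). card L)") (auto intro: psubset_card_mono)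

declare eta.simps [simp del]

end

theory Submission
  imports Defs "HOL-Library.Function_Algebras" "HOL.Vector_Spaces"
begin

text \<open>Write \<open>e\<close>, \<open>G\<close>, \<open>\<eta>\<close> and \<open>\<phi>\<close> for \<open>e\<^sub>X\<close>, its group of units, \<open>\<eta>\<^sub>X\<close> and the projection
  \<open>KM \<rightarrow> KG\<close>. The key fact is that an idempotent \<open>b\<close> of \<open>M\<close> annihilates \<open>\<eta>\<^sub>X\<close> from the left unless
  \<open>X \<subseteq> Bb\<close> (\<open>idempotent_eta_zero\<close>). It implies that the \<open>\<eta>\<^sub>X\<close> are orthogonal idempotents with sum \<open>1\<close>.
  Every element of \<open>M\<close> is a unit in the corner at some idempotent, so the key fact also shows that
  \<open>m \<eta> = 0\<close> for all \<open>m \<in> eM\<close> outside \<open>G\<close>. Hence \<open>\<eta> x \<eta> = \<phi>(x) \<eta>\<close> for all \<open>x \<in> KM\<close>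
  (\<open>eta_sandwich_projection\<close>), whereas \<open>\<phi>(\<eta>) = e\<close> and \<open>\<phi>\<close> is the identity on \<open>KG\<close>.

  The rest is ring theory in the locale \<open>corner_retraction\<close>. The map \<open>s \<mapsto> s \<eta>\<close> is a
  multiplicative bijection from \<open>KG\<close> onto \<open>\<eta> KM \<eta>\<close> with inverse \<open>\<phi>\<close>. It sends \<open>\<theta>\<close> to
  \<open>\<gamma> = \<eta> \<theta> \<eta> = \<theta> \<eta>\<close>, so \<open>\<gamma>\<close> is primitive (\<open>primitive_idempotent_lift\<close>), and the products and sums of
  the \<open>\<gamma>\<close> follow from those of the \<open>\<theta>\<close> and the \<open>\<eta>\<close>. The module \<open>KM \<gamma>\<close> is projective because \<open>\<gamma>\<close> is
  idempotent, and \<open>\<phi>\<close> maps it onto \<open>KG \<theta>\<close>. The preimage of \<open>rad(KG) \<theta>\<close> is superfluous because \<open>1 - j\<close> is left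
  invertible for \<open>j\<close> in the radical (\<open>projective_cover_lift\<close>).

  That \<open>KG \<theta> / rad(KG) \<theta>\<close> is simple (\<open>simple_module_top\<close>) rests on finite dimension only through one
  property: for each \<open>x\<close> some power \<open>x^n\<close> is \<open>x^(n + 1) w\<close> with \<open>w\<close> commuting with \<open>x\<close>. By this property,
  left ideals that are not nil contain nonzero idempotents.\<close>

section \<open>Left modules, left ideals and quotients\<close>

lemma (in left_module) smult_zero_left:
  assumes "v \<in> carrier V" shows "\<zero>\<^bsub>R\<^esub> \<odot>\<^bsub>V\<^esub> v = \<zero>\<^bsub>V\<^esub>"
proof -
  have "\<zero>\<^bsub>R\<^esub> \<odot>\<^bsub>V\<^esub> v \<oplus>\<^bsub>V\<^esub> \<zero>\<^bsub>R\<^esub> \<odot>\<^bsub>V\<^esub> v = \<zero>\<^bsub>R\<^esub> \<odot>\<^bsub>V\<^esub> v"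
    using smult_l_distr[of "\<zero>\<^bsub>R\<^esub>" "\<zero>\<^bsub>R\<^esub>" v] assms by simp
  then show ?thesis
    using smult_closed[OF R.zero_closed assms] by (metis V.add.l_cancel_one')
qed

lemma (in left_module) smult_minus_one:
  assumes v: "v \<in> carrier V" shows "(\<ominus>\<^bsub>R\<^esub> \<one>\<^bsub>R\<^esub>) \<odot>\<^bsub>V\<^esub> v = \<ominus>\<^bsub>V\<^esub> v"
proof -
  have "(\<ominus>\<^bsub>R\<^esub> \<one>\<^bsub>R\<^esub>) \<odot>\<^bsub>V\<^esub> v \<oplus>\<^bsub>V\<^esub> v = (\<ominus>\<^bsub>R\<^esub> \<one>\<^bsub>R\<^esub> \<oplus>\<^bsub>R\<^esub> \<one>\<^bsub>R\<^esub>) \<odot>\<^bsub>V\<^esub> v"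
    using v by (simp add: smult_l_distr smult_one)
  also have "\<dots> = \<zero>\<^bsub>V\<^esub>"
    using v by (simp add: R.l_neg smult_zero_left)
  finally show ?thesis
    using v smult_closed by (metis R.a_inv_closed R.one_closed V.minus_equality)
qed

lemma (in left_module) submodule_iff:
  "submodule N R V \<longleftrightarrow> N \<subseteq> carrier V \<and> \<zero>\<^bsub>V\<^esub> \<in> N \<and> (\<forall>x\<in>N. \<forall>y\<in>N. x \<oplus>\<^bsub>V\<^esub> y \<in> N) \<and>
     (\<forall>a\<in>carrier R. \<forall>x\<in>N. a \<odot>\<^bsub>V\<^esub> x \<in> N)" (is "_ \<longleftrightarrow> ?rhs")
proof
  assume "submodule N R V"
  then interpret N: submodule N R V .
  show ?rhs
    using N.subset N.one_closed N.m_closed N.smult_closed by auto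
next
  assume rhs: ?rhs
  then have "\<ominus>\<^bsub>V\<^esub> x \<in> N" if "x \<in> N" for x
    using smult_minus_one[of x] that by (metis R.a_inv_closed R.one_closed subsetD)
  with rhs show "submodule N R V"
    by unfold_locales (auto simp: a_inv_def)
qed

lemma (in left_module) submodule_abelian_subgroup:
  assumes "submodule N R V" shows "abelian_subgroup N V"
  using assms V.abelian_group_axioms
  by (intro abelian_subgroupI3 additive_subgroupI) (auto simp: submodule_def)

lemma (in ring) left_ideal_module_of_closed:
  assumes I: "I \<subseteq> carrier R" "\<zero> \<in> I" "\<And>x y. x \<in> I \<Longrightarrow> y \<in> I \<Longrightarrow> x \<oplus> y \<in> I"
    and smult: "\<And>a x. a \<in> carrier R \<Longrightarrow> x \<in> I \<Longrightarrow> a \<otimes> x \<in> I"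
  shows "left_module R (left_ideal_module R I)"
proof -
  have inv: "\<ominus> x \<in> I" if "x \<in> I" for x
  proof -
    have "(\<ominus> \<one>) \<otimes> x \<in> I" using smult that by simp
    then show ?thesis using that I by (simp add: l_minus subsetD)
  qed
  show ?thesis
  proof (intro left_module.intro ring_axioms left_module_axioms.intro abelian_groupI)
    fix x assume "x \<in> carrier (left_ideal_module R I)"
    then show "\<exists>y\<in>carrier (left_ideal_module R I).
        y \<oplus>\<^bsub>left_ideal_module R I\<^esub> x = \<zero>\<^bsub>left_ideal_module R I\<^esub>"
      using inv[of x] I(1) by (auto simp: left_ideal_module_def l_neg intro!: bexI[of _ "\<ominus> x"])
  qed (use I smult in \<open>auto simp: left_ideal_module_def subset_iff a_ac l_distr r_distr m_assoc\<close>)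
qed

lemma (in ring) left_ideal_iff:
  "left_ideal I R \<longleftrightarrow> I \<subseteq> carrier R \<and> \<zero> \<in> I \<and> (\<forall>x\<in>I. \<forall>y\<in>I. x \<oplus> y \<in> I) \<and>
     (\<forall>a\<in>carrier R. \<forall>x\<in>I. a \<otimes> x \<in> I)"
proof -
  interpret left_module R "left_ideal_module R (carrier R)"
    by (rule left_ideal_module_of_closed) auto
  show ?thesis
    unfolding left_ideal_def submodule_iff by (simp add: left_ideal_module_def)
qed

lemma (in ring) left_module_left_ideal:
  assumes "left_ideal I R" shows "left_module R (left_ideal_module R I)"
  using assms by (intro left_ideal_module_of_closed) (auto simp: left_ideal_iff)

lemma (in ring) submodule_left_ideal_iff:
  assumes "left_ideal I R"
  shows "submodule N R (left_ideal_module R I) \<longleftrightarrow> left_ideal N R \<and> N \<subseteq> I"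
proof -
  interpret left_module R "left_ideal_module R I"
    by (rule left_module_left_ideal[OF assms])
  show ?thesis
    using assms unfolding submodule_iff left_ideal_iff by (auto simp: left_ideal_module_def)
qed

lemma (in ring) left_ideal_right_translate:
  assumes A: "left_ideal A R" and x: "x \<in> carrier R"
  shows "left_ideal (right_translate R A x) R"
  unfolding left_ideal_iff right_translate_def
proof (intro conjI ballI)
  show "(\<lambda>a. a \<otimes> x) ` A \<subseteq> carrier R" using A x by (auto simp: left_ideal_iff)
  show "\<zero> \<in> (\<lambda>a. a \<otimes> x) ` A" using A x by (auto simp: left_ideal_iff image_iff intro!: bexI[of _ \<zero>])
  fix u assume "u \<in> (\<lambda>a. a \<otimes> x) ` A"
  then obtain a where a: "a \<in> A" "u = a \<otimes> x" by auto
  have aR: "a \<in> carrier R" using a A by (auto simp: left_ideal_iff)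
  {
    fix v assume "v \<in> (\<lambda>a. a \<otimes> x) ` A"
    then obtain b where b: "b \<in> A" "v = b \<otimes> x" by auto
    have "b \<in> carrier R" using b A by (auto simp: left_ideal_iff)
    then show "u \<oplus> v \<in> (\<lambda>a. a \<otimes> x) ` A"
      using a b A x aR by (auto simp: left_ideal_iff l_distr image_iff intro!: bexI[of _ "a \<oplus> b"])
  }
  fix r assume "r \<in> carrier R"
  then show "r \<otimes> u \<in> (\<lambda>a. a \<otimes> x) ` A"
    using a A x aR by (auto simp: left_ideal_iff m_assoc image_iff intro!: bexI[of _ "r \<otimes> a"])
qed

lemma (in ring) left_ideal_carrier: "left_ideal (carrier R) R"
  by (auto simp: left_ideal_iff)

context left_module
begin

lemma quotient_smult_coset:
  assumes N: "submodule N R V" and a: "a \<in> carrier R" and v: "v \<in> carrier V"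
  shows "a \<odot>\<^bsub>quotient_module V N\<^esub> (N +>\<^bsub>V\<^esub> v) = N +>\<^bsub>V\<^esub> (a \<odot>\<^bsub>V\<^esub> v)"
proof -
  interpret N: abelian_subgroup N V by (rule submodule_abelian_subgroup[OF N])
  have closed: "N \<subseteq> carrier V" "a \<odot>\<^bsub>V\<^esub> n \<in> N" if "n \<in> N" for n
    using N that a by (auto simp: submodule_iff)
  have "N +>\<^bsub>V\<^esub> (a \<odot>\<^bsub>V\<^esub> w) = N +>\<^bsub>V\<^esub> (a \<odot>\<^bsub>V\<^esub> v)" if w: "w \<in> N +>\<^bsub>V\<^esub> v" for w
  proof -
    obtain n where n: "n \<in> N" "w = n \<oplus>\<^bsub>V\<^esub> v" using w by (auto simp: a_r_coset_def')
    then have "a \<odot>\<^bsub>V\<^esub> w = a \<odot>\<^bsub>V\<^esub> n \<oplus>\<^bsub>V\<^esub> a \<odot>\<^bsub>V\<^esub> v"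
      using closed a v by (auto intro!: smult_r_distr)
    then have "a \<odot>\<^bsub>V\<^esub> w \<in> N +>\<^bsub>V\<^esub> (a \<odot>\<^bsub>V\<^esub> v)"
      using closed(2)[OF n(1)] by (auto simp: a_r_coset_def')
    then show ?thesis
      using a v smult_closed N.a_subgroup by (metis V.a_repr_independence)
  qed
  moreover have "N +>\<^bsub>V\<^esub> v \<noteq> {}" using N.a_rcos_self[OF v] by auto
  ultimately show ?thesis by (auto simp: quotient_module_def)
qed

lemma quotient_add_coset:
  assumes N: "submodule N R V" and "v \<in> carrier V" "w \<in> carrier V"
  shows "(N +>\<^bsub>V\<^esub> v) \<oplus>\<^bsub>quotient_module V N\<^esub> (N +>\<^bsub>V\<^esub> w) = N +>\<^bsub>V\<^esub> (v \<oplus>\<^bsub>V\<^esub> w)"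
  using abelian_subgroup.a_rcos_sum[OF submodule_abelian_subgroup[OF N]] assms
  by (simp add: quotient_module_def)

lemma quotient_carrier:
  "carrier (quotient_module V N) = (\<lambda>v. N +>\<^bsub>V\<^esub> v) ` carrier V"
  by (auto simp: quotient_module_def A_RCOSETS_def')

lemma coset_eq_zero_iff:
  assumes N: "submodule N R V" and v: "v \<in> carrier V"
  shows "N +>\<^bsub>V\<^esub> v = N \<longleftrightarrow> v \<in> N"
  using N v V.a_coset_join1[of N v] V.a_coset_join2[of v N] by (auto simp: submodule_def)

lemma left_module_quotient:
  assumes N: "submodule N R V"
  shows "left_module R (quotient_module V N)"
proof -
  interpret N: abelian_subgroup N V by (rule submodule_abelian_subgroup[OF N])
  have zero: "\<zero>\<^bsub>quotient_module V N\<^esub> = N +>\<^bsub>V\<^esub> \<zero>\<^bsub>V\<^esub>"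
    using N.a_subset by (simp add: quotient_module_def)
  have "abelian_group (quotient_module V N)"
  proof (rule abelian_groupI)
    fix C assume "C \<in> carrier (quotient_module V N)"
    then obtain v where v: "v \<in> carrier V" "C = N +>\<^bsub>V\<^esub> v" by (auto simp: quotient_carrier)
    then show "\<exists>D\<in>carrier (quotient_module V N).
        D \<oplus>\<^bsub>quotient_module V N\<^esub> C = \<zero>\<^bsub>quotient_module V N\<^esub>"
      by (intro bexI[of _ "N +>\<^bsub>V\<^esub> (\<ominus>\<^bsub>V\<^esub> v)"])
        (auto simp: zero quotient_add_coset[OF N] V.l_neg quotient_carrier)
  qed (auto simp: zero quotient_carrier quotient_add_coset[OF N] V.a_ac)
  moreover have "left_module_axioms R (quotient_module V N)"
    using N by (intro left_module_axioms.intro;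
      auto simp: quotient_carrier quotient_smult_coset quotient_add_coset smult_closed
        smult_l_distr smult_r_distr smult_assoc smult_one)
  ultimately show ?thesis by (intro left_module.intro R.ring_axioms)
qed

text \<open>The correspondence theorem: submodules of the quotient pull back to submodules of \<open>V\<close>
  lying above \<open>N\<close>.\<close>

lemma simple_quotientI:
  assumes N: "submodule N R V" and proper: "N \<noteq> carrier V"
    and max: "\<And>L. submodule L R V \<Longrightarrow> N \<subseteq> L \<Longrightarrow> L \<subseteq> N \<or> L = carrier V"
  shows "simple_module R (quotient_module V N)"
  unfolding simple_module_def
proof (intro conjI allI impI left_module_quotient N)
  let ?Q = "quotient_module V N"
  interpret Q: left_module R ?Q by (rule left_module_quotient[OF N])
  have zero: "\<zero>\<^bsub>?Q\<^esub> = N" by (simp add: quotient_module_def)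
  have NV: "N \<subseteq> carrier V" "\<zero>\<^bsub>V\<^esub> \<in> N" using N by (auto simp: submodule_iff)
  show "carrier ?Q \<noteq> {\<zero>\<^bsub>?Q\<^esub>}"
  proof
    assume triv: "carrier ?Q = {\<zero>\<^bsub>?Q\<^esub>}"
    have "v \<in> N" if v: "v \<in> carrier V" for v
    proof -
      have "N +>\<^bsub>V\<^esub> v \<in> carrier ?Q" using v by (simp add: quotient_carrier)
      then show ?thesis using triv zero coset_eq_zero_iff[OF N v] by simp
    qed
    then show False using proper NV by blast
  qed
  fix P assume P: "submodule P R ?Q"
  define L where "L = {v \<in> carrier V. N +>\<^bsub>V\<^esub> v \<in> P}"
  have P': "P \<subseteq> carrier ?Q" "N \<in> P" "\<And>x y. x \<in> P \<Longrightarrow> y \<in> P \<Longrightarrow> x \<oplus>\<^bsub>?Q\<^esub> y \<in> P"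
      "\<And>a x. a \<in> carrier R \<Longrightarrow> x \<in> P \<Longrightarrow> a \<odot>\<^bsub>?Q\<^esub> x \<in> P"
    using P zero by (auto simp: Q.submodule_iff)
  have "submodule L R V"
    unfolding submodule_iff L_def using P' NV coset_eq_zero_iff[OF N]
    by (auto simp: quotient_add_coset[OF N, symmetric] quotient_smult_coset[OF N, symmetric]
        smult_closed)
  moreover have "N \<subseteq> L"
  proof
    fix x assume "x \<in> N"
    then have "x \<in> carrier V" "N +>\<^bsub>V\<^esub> x = N" using NV coset_eq_zero_iff[OF N, of x] by auto
    then show "x \<in> L" using P'(2) by (simp add: L_def)
  qed
  moreover have "P = (\<lambda>v. N +>\<^bsub>V\<^esub> v) ` L"
    using P'(1) by (auto simp: L_def quotient_carrier)
  ultimately show "P = {\<zero>\<^bsub>?Q\<^esub>} \<or> P = carrier ?Q"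
  proof -
    assume L: "submodule L R V" "N \<subseteq> L" and PL: "P = (\<lambda>v. N +>\<^bsub>V\<^esub> v) ` L"
    from max[OF L] show ?thesis
    proof
      assume "L \<subseteq> N"
      then have "P \<subseteq> {N}"
        unfolding PL using coset_eq_zero_iff[OF N] NV by auto
      then show ?thesis using P'(2) zero by auto
    next
      assume "L = carrier V"
      then show ?thesis by (simp add: PL quotient_carrier)
    qed
  qed
qed

end

lemma left_module_restrict_scalars:
  assumes R: "ring R" and f: "f \<in> ring_hom R S" and V: "left_module S V"
  shows "left_module R (restrict_scalars f V)"
proof -
  interpret V: left_module S V by (rule V)
  have "abelian_group (restrict_scalars f V)"
  proof (rule abelian_groupI)
    fix v assume "v \<in> carrier (restrict_scalars f V)"
    then show "\<exists>w\<in>carrier (restrict_scalars f V).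
        w \<oplus>\<^bsub>restrict_scalars f V\<^esub> v = \<zero>\<^bsub>restrict_scalars f V\<^esub>"
      by (intro bexI[of _ "\<ominus>\<^bsub>V\<^esub> v"]) (auto simp: restrict_scalars_def V.V.l_neg)
  qed (auto simp: restrict_scalars_def V.V.a_ac)
  moreover have "left_module_axioms R (restrict_scalars f V)"
    using f by (intro left_module_axioms.intro)
      (auto simp: restrict_scalars_def ring_hom_closed ring_hom_add ring_hom_mult ring_hom_one
        V.smult_closed V.smult_l_distr V.smult_r_distr V.smult_assoc V.smult_one)
  ultimately show ?thesis by (intro left_module.intro R)
qed

section \<open>The Jacobson radical and tops of principal projective modules\<close>

context ring
begin

lemma left_ideal_one: "left_ideal I R \<Longrightarrow> \<one> \<in> I \<Longrightarrow> I = carrier R"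
  unfolding left_ideal_iff using r_one by (metis subsetI subset_antisym)

lemma left_ideal_jacobson_radical: "left_ideal (jacobson_radical R) R"
  unfolding jacobson_radical_def maximal_left_ideal_def left_ideal_iff by auto

lemma maximal_left_ideal_above:
  assumes I: "left_ideal I R" "\<one> \<notin> I"
  shows "\<exists>J. maximal_left_ideal J R \<and> I \<subseteq> J"
proof -
  let ?A = "{J. left_ideal J R \<and> I \<subseteq> J \<and> \<one> \<notin> J}"
  have "\<exists>M\<in>?A. \<forall>X\<in>?A. M \<subseteq> X \<longrightarrow> X = M"
  proof (rule subset_Zorn_nonempty)
    show "?A \<noteq> {}" using I by auto
    fix C assume C: "C \<noteq> {}" "subset.chain ?A C"
    then have CA: "C \<subseteq> ?A" and ch: "\<And>X Y. X \<in> C \<Longrightarrow> Y \<in> C \<Longrightarrow> X \<subseteq> Y \<or> Y \<subseteq> X"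
      by (auto simp: subset_chain_def)
    have "left_ideal (\<Union>C) R"
      unfolding left_ideal_iff
    proof (intro conjI ballI)
      show "\<Union>C \<subseteq> carrier R" "\<zero> \<in> \<Union>C" using CA C(1) by (auto simp: left_ideal_iff)
      fix x assume x: "x \<in> \<Union>C"
      { fix y assume y: "y \<in> \<Union>C"
        obtain X where X: "X \<in> C" "x \<in> X" "y \<in> X" using x y ch by blast
        then have "x \<oplus> y \<in> X" using CA by (auto simp: left_ideal_iff)
        then show "x \<oplus> y \<in> \<Union>C" using X(1) by blast }
      fix a assume a: "a \<in> carrier R"
      obtain X where X: "X \<in> C" "x \<in> X" using x by blast
      then have "a \<otimes> x \<in> X" using CA a by (auto simp: left_ideal_iff)
      then show "a \<otimes> x \<in> \<Union>C" using X(1) by blast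
    qed
    then show "\<Union>C \<in> ?A" using C(1) CA by auto
  qed
  then obtain M where "M \<in> ?A" and max: "\<forall>X\<in>?A. M \<subseteq> X \<longrightarrow> X = M" by (rule bexE)
  then have M: "left_ideal M R" "I \<subseteq> M" "\<one> \<notin> M" by simp_all
  have "maximal_left_ideal M R"
    unfolding maximal_left_ideal_def
  proof (intro conjI allI impI M(1))
    show "M \<noteq> carrier R" using M(3) by auto
    fix X assume X: "left_ideal X R \<and> M \<subseteq> X"
    show "X = M \<or> X = carrier R"
    proof (cases "\<one> \<in> X")
      case True
      then show ?thesis using X left_ideal_one by blast
    next
      case False
      then have "X \<in> ?A" using X M(2) by blast
      then show ?thesis using X max by blast
    qed
  qed
  with M(2) show ?thesis by blast
qed

text \<open>Otherwise \<open>R (1 - j)\<close> would lie in a maximal left ideal, which would contain both \<open>1 - j\<close> and \<open>j\<close>.\<close>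

lemma jacobson_radical_left_inverse:
  assumes j: "j \<in> jacobson_radical R"
  shows "\<exists>u\<in>carrier R. u \<otimes> (\<one> \<ominus> j) = \<one>"
proof (rule ccontr)
  assume no: "\<not> ?thesis"
  have jR: "j \<in> carrier R" using j by (simp add: jacobson_radical_def)
  let ?I = "right_translate R (carrier R) (\<one> \<ominus> j)"
  have "left_ideal ?I R" "\<one> \<notin> ?I"
    using no jR left_ideal_right_translate[OF left_ideal_carrier, of "\<one> \<ominus> j"]
    by (auto simp: right_translate_def)
  then obtain J where J: "maximal_left_ideal J R" "?I \<subseteq> J" using maximal_left_ideal_above by blast
  have "\<one> \<ominus> j \<in> ?I" unfolding right_translate_def using jR by (auto intro!: image_eqI[of _ _ \<one>])
  moreover have "j \<in> J" using j J(1) by (auto simp: jacobson_radical_def)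
  ultimately have "(\<one> \<ominus> j) \<oplus> j \<in> J"
    using J by (auto simp: maximal_left_ideal_def left_ideal_iff)
  moreover have "(\<one> \<ominus> j) \<oplus> j = \<one>" using jR by (simp add: minus_eq a_assoc l_neg)
  ultimately have "\<one> \<in> J" by simp
  then show False using J(1) left_ideal_one[of J] unfolding maximal_left_ideal_def by blast
qed

text \<open>If a maximal left ideal \<open>J\<close> misses \<open>x \<in> N\<close>, then \<open>1 = i + y\<close> with \<open>i \<in> J\<close> and \<open>y = s x\<close>
  nilpotent. Modulo \<open>J\<close> the powers of \<open>y\<close> are all congruent to \<open>1\<close>, because
  \<open>y^n - y^(n + 1) = y^n i\<close>; so \<open>1 \<in> J\<close>, which is absurd.\<close>

lemma nil_left_ideal_subset_jacobson_radical:
  assumes N: "left_ideal N R" and nil: "\<And>x. x \<in> N \<Longrightarrow> \<exists>n::nat. x [^] n = \<zero>"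
  shows "N \<subseteq> jacobson_radical R"
proof
  fix x assume x: "x \<in> N"
  then have xR: "x \<in> carrier R" using N by (auto simp: left_ideal_iff)
  have "x \<in> J" if J: "maximal_left_ideal J R" for J
  proof (rule ccontr)
    assume xJ: "x \<notin> J"
    have JI: "left_ideal J R" using J by (simp add: maximal_left_ideal_def)
    then have JR: "\<And>i. i \<in> J \<Longrightarrow> i \<in> carrier R" by (auto simp: left_ideal_iff)
    have max: "X = J \<or> X = carrier R" if "left_ideal X R" "J \<subseteq> X" for X
      using J that by (simp add: maximal_left_ideal_def)
    let ?K = "{i \<oplus> s \<otimes> x | i s. i \<in> J \<and> s \<in> carrier R}"
    have K: "left_ideal ?K R"
      unfolding left_ideal_iff
    proof (intro conjI ballI)
      show "?K \<subseteq> carrier R" using JR xR by auto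
      show "\<zero> \<in> ?K" using JI xR
        by (auto simp: left_ideal_iff intro!: exI[of _ \<zero>])
      fix u assume "u \<in> ?K"
      then obtain i s where u: "u = i \<oplus> s \<otimes> x" "i \<in> J" "s \<in> carrier R" by blast
      { fix v assume "v \<in> ?K"
        then obtain i' s' where v: "v = i' \<oplus> s' \<otimes> x" "i' \<in> J" "s' \<in> carrier R" by blast
        have "u \<oplus> v = (i \<oplus> i') \<oplus> (s \<oplus> s') \<otimes> x"
          using u v JR xR by (simp add: l_distr a_ac)
        moreover have "i \<oplus> i' \<in> J" "s \<oplus> s' \<in> carrier R" using u v JI by (auto simp: left_ideal_iff)
        ultimately show "u \<oplus> v \<in> ?K" by blast }
      fix a assume a: "a \<in> carrier R"
      have "a \<otimes> u = a \<otimes> i \<oplus> (a \<otimes> s) \<otimes> x" using a u JR xR by (simp add: r_distr m_assoc)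
      moreover have "a \<otimes> i \<in> J" "a \<otimes> s \<in> carrier R" using a u JI by (auto simp: left_ideal_iff)
      ultimately show "a \<otimes> u \<in> ?K" by blast
    qed
    have JK: "J \<subseteq> ?K"
    proof
      fix i assume "i \<in> J"
      then show "i \<in> ?K" using JR xR by (intro CollectI exI[of _ i] exI[of _ \<zero>]) auto
    qed
    have xK: "x \<in> ?K"
      using JI xR by (intro CollectI exI[of _ \<zero>] exI[of _ \<one>]) (auto simp: left_ideal_iff)
    have "\<one> \<in> ?K"
      using max[OF K JK]
    proof
      assume "?K = J"
      then show ?thesis using xK xJ by (simp only:)
    next
      assume "?K = carrier R"
      then show ?thesis by (simp only: one_closed)
    qed
    then obtain i s where dec: "\<one> = i \<oplus> s \<otimes> x" "i \<in> J" "s \<in> carrier R" by blast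
    let ?y = "s \<otimes> x"
    have y: "?y \<in> N" "?y \<in> carrier R" using dec x xR N by (auto simp: left_ideal_iff)
    have i: "i = \<one> \<ominus> ?y" using dec(1) y(2) JR[OF dec(2)] by (simp add: minus_eq a_assoc r_neg)
    have "\<one> \<ominus> ?y [^] n \<in> J" for n :: nat
    proof (induction n)
      case 0
      then show ?case using JI by (simp add: minus_eq r_neg left_ideal_iff)
    next
      case (Suc n)
      have "\<one> \<ominus> ?y [^] Suc n = (\<one> \<ominus> ?y [^] n) \<oplus> ?y [^] n \<otimes> i"
        unfolding i using y(2) by (simp add: minus_eq r_distr r_minus a_assoc r_neg1)
      then show ?case using Suc dec(2) y(2) JI by (simp add: left_ideal_iff)
    qed
    moreover obtain n :: nat where "?y [^] n = \<zero>" using nil[OF y(1)] by (rule exE)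
    ultimately have "\<one> \<ominus> \<zero> \<in> J" by metis
    then have "\<one> \<in> J" by (simp add: minus_eq)
    then show False using J left_ideal_one[of J] unfolding maximal_left_ideal_def by blast
  qed
  then show "x \<in> jacobson_radical R" using xR by (simp add: jacobson_radical_def)
qed

end

text \<open>Each finite-dimensional algebra has this property, because the powers of an element are
  linearly dependent there. It is what the theory of primitive idempotents takes from
  finite-dimensionality.\<close>

definition strongly_pi_regular :: "('r, 'x) ring_scheme \<Rightarrow> bool" where
  "strongly_pi_regular R \<longleftrightarrow> (\<forall>x\<in>carrier R. \<exists>n::nat. \<exists>w\<in>carrier R.
     x \<otimes>\<^bsub>R\<^esub> w = w \<otimes>\<^bsub>R\<^esub> x \<and> x [^]\<^bsub>R\<^esub> n = x [^]\<^bsub>R\<^esub> Suc n \<otimes>\<^bsub>R\<^esub> w)"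

context ring
begin

text \<open>Fitting's decomposition: if \<open>x^m = x^(2 m) w^m\<close> with \<open>w\<close> commuting with \<open>x\<close>, then \<open>w^m x^m\<close> is
  an idempotent.\<close>

lemma nonzero_idempotent_in_left_ideal:
  assumes reg: "strongly_pi_regular R" and N: "left_ideal N R" and x: "x \<in> N"
    and nnil: "\<And>n::nat. x [^] n \<noteq> \<zero>"
  shows "\<exists>f\<in>N. f \<otimes> f = f \<and> f \<noteq> \<zero>"
proof -
  have xR: "x \<in> carrier R" using x N by (auto simp: left_ideal_iff)
  obtain n :: nat and w where w: "w \<in> carrier R" "x \<otimes> w = w \<otimes> x"
    and n: "x [^] n = x [^] Suc n \<otimes> w"
    using reg xR unfolding strongly_pi_regular_def by metis
  \<comment> \<open>A positive exponent is needed so that the power lies in \<open>N\<close>.\<close>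
  let ?m = "Suc n"
  have step: "x [^] Suc k = x [^] Suc (Suc k) \<otimes> w" if "x [^] k = x [^] Suc k \<otimes> w" for k
    using that xR w by (metis m_assoc m_closed nat_pow_Suc nat_pow_closed)
  have m: "x [^] ?m = x [^] (?m + k) \<otimes> w [^] k" for k
  proof (induction k)
    case 0
    then show ?case using xR by simp
  next
    case (Suc k)
    have "x [^] (n + j) = x [^] Suc (n + j) \<otimes> w" for j
      by (induction j) (use n step in auto)
    then have "x [^] (?m + k) = x [^] (?m + Suc k) \<otimes> w"
      by (metis add_Suc add_Suc_right)
    moreover have "w \<otimes> w [^] k = w [^] Suc k" using w(1) by (metis nat_pow_Suc2)
    ultimately show ?case using Suc xR w(1) by (metis m_assoc nat_pow_closed)
  qed
  let ?X = "x [^] ?m" and ?W = "w [^] ?m"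
  have XW: "?X \<in> carrier R" "?W \<in> carrier R" using xR w(1) by auto
  have comm: "?X \<otimes> ?W = ?W \<otimes> ?X"
  proof -
    have "w \<otimes> x [^] k = x [^] k \<otimes> w" for k :: nat
      by (rule group_commutes_pow[symmetric]) (use xR w in auto)
    then show ?thesis by (metis group_commutes_pow xR nat_pow_closed w(1))
  qed
  have XXW: "?X \<otimes> ?X \<otimes> ?W = ?X" using m[of ?m] nat_pow_mult[OF xR, of ?m ?m] by metis
  have "(?W \<otimes> ?X) \<otimes> (?W \<otimes> ?X) = ?W \<otimes> (?X \<otimes> ?X \<otimes> ?W)"
    using XW comm by (metis m_assoc m_closed)
  then have "(?W \<otimes> ?X) \<otimes> (?W \<otimes> ?X) = ?W \<otimes> ?X" using XXW by simp
  moreover have "?W \<otimes> ?X \<noteq> \<zero>"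
  proof
    assume "?W \<otimes> ?X = \<zero>"
    then have "?X \<otimes> (?X \<otimes> ?W) = \<zero>" using comm XW by simp
    then show False using XXW XW nnil[of ?m] by (simp add: m_assoc)
  qed
  moreover have "?W \<otimes> ?X \<in> N"
  proof -
    have "?W \<otimes> ?X = (?W \<otimes> x [^] n) \<otimes> x" using XW xR by (simp add: m_assoc)
    then show ?thesis using N x XW xR by (auto simp: left_ideal_iff)
  qed
  ultimately show ?thesis by blast
qed

text \<open>The hypotheses make \<open>t f\<close> an idempotent of \<open>t R t\<close>, and \<open>t = t f + (t - t f)\<close> is an orthogonal
  decomposition. The summand \<open>t f\<close> does not vanish, since \<open>f (t f) = f\<close>.\<close>

lemma primitive_idempotent_absorbs:
  assumes t: "primitive_idempotent R t"
    and f: "f \<in> carrier R" "f \<otimes> f = f" "f \<noteq> \<zero>" "f \<otimes> t = f"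
  shows "t \<otimes> f = t"
proof -
  have tR: "t \<in> carrier R" "t \<otimes> t = t" using t by (auto simp: primitive_idempotent_def idempotent_element_def)
  let ?a = "t \<otimes> f" and ?b = "t \<ominus> t \<otimes> f"
  have ta: "t \<otimes> ?a = ?a" using tR f(1) by (metis m_assoc)
  have at: "?a \<otimes> t = ?a" using tR f(1,4) by (simp add: m_assoc)
  have aa: "?a \<otimes> ?a = ?a" using tR f at by (metis m_assoc m_closed)
  have aR: "?a \<in> carrier R" using tR f by simp
  have ab: "?a \<otimes> ?b = \<zero>" "?b \<otimes> ?a = \<zero>"
    using tR aR ta at aa by (simp_all add: minus_eq r_distr l_distr r_minus l_minus r_neg)
  have bb: "?b \<otimes> ?b = ?b"
  proof -
    have "?b \<otimes> ?b = ?b \<otimes> t \<ominus> ?b \<otimes> ?a" using tR aR by (simp add: minus_eq r_distr r_minus)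
    also have "\<dots> = ?b \<otimes> t" using ab tR aR by (simp add: minus_eq)
    also have "\<dots> = ?b" using tR aR at by (simp add: minus_eq l_distr l_minus)
    finally show ?thesis .
  qed
  have "t = ?a \<oplus> ?b" using tR aR by (simp add: minus_eq r_neg a_lcomm)
  then have "?a = \<zero> \<or> ?b = \<zero>"
    using t ab aa bb tR(1) aR minus_closed[OF tR(1) aR]
    unfolding primitive_idempotent_def orthogonal_elements_def idempotent_element_def by blast
  moreover have "?a \<noteq> \<zero>" using f tR by (metis m_assoc r_null)
  ultimately have "?b = \<zero>" by simp
  then show ?thesis using tR aR by (metis minus_eq a_inv_closed minus_equality minus_minus)
qed

text \<open>If \<open>t = j t\<close> with \<open>j\<close> in the radical, then \<open>(1 - j) t = 0\<close>, and \<open>1 - j\<close> has a left inverse.\<close>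

lemma radical_translate_proper:
  assumes t: "t \<in> carrier R" "t \<noteq> \<zero>"
  shows "right_translate R (jacobson_radical R) t \<noteq> right_translate R (carrier R) t"
proof
  assume eq: "right_translate R (jacobson_radical R) t = right_translate R (carrier R) t"
  have "t \<in> right_translate R (carrier R) t"
    unfolding right_translate_def using t by (auto intro!: image_eqI[of _ _ \<one>])
  then have "t \<in> right_translate R (jacobson_radical R) t" unfolding eq .
  then obtain j where j: "j \<in> jacobson_radical R" "j \<otimes> t = t"
    unfolding right_translate_def by (elim imageE) simp
  have jR: "j \<in> carrier R" using j by (simp add: jacobson_radical_def)
  obtain u where u: "u \<in> carrier R" "u \<otimes> (\<one> \<ominus> j) = \<one>"
    using jacobson_radical_left_inverse[OF j(1)] by blast
  have "(\<one> \<ominus> j) \<otimes> t = t \<ominus> j \<otimes> t" using jR t by (simp add: minus_eq l_distr l_minus)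
  also have "\<dots> = \<zero>" using j(2) t by (simp add: minus_eq r_neg)
  finally have 0: "(\<one> \<ominus> j) \<otimes> t = \<zero>" .
  have "u \<otimes> ((\<one> \<ominus> j) \<otimes> t) = t"
    using m_assoc[of u "\<one> \<ominus> j" t] u t(1) jR by simp
  then show False unfolding 0 using t(2) u(1) by simp
qed

text \<open>Let \<open>J\<close> be the radical and \<open>R t / J t\<close> the top of \<open>R t\<close>. A left ideal \<open>N \<subseteq> R t\<close> that is
  not inside \<open>J\<close> is not nil, so it contains a nonzero idempotent \<open>f\<close>, and then \<open>t = t f\<close> lies in \<open>N\<close>.\<close>

lemma simple_module_top:
  assumes reg: "strongly_pi_regular R" and t: "primitive_idempotent R t"
  shows "simple_module R (quotient_module
    (left_ideal_module R (right_translate R (carrier R) t))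
    (right_translate R (jacobson_radical R) t))"
proof -
  let ?P = "right_translate R (carrier R) t" and ?J = "right_translate R (jacobson_radical R) t"
  have tR: "t \<in> carrier R" "t \<otimes> t = t" "t \<noteq> \<zero>"
    using t by (auto simp: primitive_idempotent_def idempotent_element_def)
  have P: "left_ideal ?P R" by (rule left_ideal_right_translate[OF left_ideal_carrier tR(1)])
  have J: "left_ideal ?J R"
    by (rule left_ideal_right_translate[OF left_ideal_jacobson_radical tR(1)])
  interpret V: left_module R "left_ideal_module R ?P" by (rule left_module_left_ideal[OF P])
  have carr: "carrier (left_ideal_module R ?P) = ?P" by (simp add: left_ideal_module_def)
  show ?thesis
  proof (rule V.simple_quotientI)
    show "submodule ?J R (left_ideal_module R ?P)"
      unfolding submodule_left_ideal_iff[OF P]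
      using J by (auto simp: right_translate_def jacobson_radical_def)
    show "?J \<noteq> carrier (left_ideal_module R ?P)" unfolding carr by (rule radical_translate_proper[OF tR(1,3)])
    fix L assume "submodule L R (left_ideal_module R ?P)" and "?J \<subseteq> L"
    then have L: "left_ideal L R" "L \<subseteq> ?P" by (auto simp: submodule_left_ideal_iff[OF P])
    have Lt: "x \<in> carrier R" "x \<otimes> t = x" if "x \<in> L" for x
      using that L tR by (auto simp: right_translate_def m_assoc dest!: subsetD)
    show "L \<subseteq> ?J \<or> L = carrier (left_ideal_module R ?P)"
    proof (cases "\<forall>x\<in>L. \<exists>n::nat. x [^] n = \<zero>")
      case True
      then have "L \<subseteq> jacobson_radical R"
        by (intro nil_left_ideal_subset_jacobson_radical[OF L(1)]) simp
      then have "x \<in> ?J" if "x \<in> L" for x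
        unfolding right_translate_def using Lt(2)[OF that] that by (intro image_eqI[of _ _ x]) auto
      then show ?thesis by blast
    next
      case False
      then obtain f where f: "f \<in> L" "f \<otimes> f = f" "f \<noteq> \<zero>"
        using nonzero_idempotent_in_left_ideal[OF reg L(1)] by metis
      then have "t \<otimes> f = t" by (intro primitive_idempotent_absorbs[OF t] Lt)
      moreover have "t \<otimes> f \<in> L" using L(1) f(1) tR(1) by (simp add: left_ideal_iff)
      ultimately have "t \<in> L" by simp
      then have "?P \<subseteq> L" using L(1) by (auto simp: right_translate_def left_ideal_iff)
      then show ?thesis using L(2) carr by auto
    qed
  qed
qed

text \<open>A homomorphism from \<open>R p\<close> is determined by the image of the idempotent \<open>p\<close>, and any preimage
  of that image may be prescribed.\<close>

lemma projective_module_idempotent: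
  assumes p: "idempotent_element R p"
  shows "projective_module A B R (left_ideal_module R (right_translate R (carrier R) p))"
  unfolding projective_module_def
proof (intro conjI allI ballI impI)
  let ?P = "right_translate R (carrier R) p"
  have pR: "p \<in> carrier R" "p \<otimes> p = p" using p by (auto simp: idempotent_element_def)
  have PI: "left_ideal ?P R" by (rule left_ideal_right_translate[OF left_ideal_carrier pR(1)])
  show "left_module R (left_ideal_module R ?P)" by (rule left_module_left_ideal[OF PI])
  fix V :: "('a, 'c) module" and W :: "('a, 'd) module" and g h
  assume g: "g \<in> left_module_hom R V W" and h: "h \<in> left_module_hom R (left_ideal_module R ?P) W"
    and V: "left_module R V" and W: "left_module R W" and surj: "g ` carrier V = carrier W"
  interpret V: left_module R V by (rule V)
  have pP: "p \<in> ?P" unfolding right_translate_def using pR by (auto intro!: image_eqI[of _ _ \<one>])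
  have Pp: "x \<in> carrier R" "x \<otimes> p = x" if "x \<in> ?P" for x
    using that pR by (auto simp: right_translate_def m_assoc)
  have "h p \<in> carrier W" using h pP by (auto simp: left_module_hom_def left_ideal_module_def)
  then obtain v where v: "v \<in> carrier V" "g v = h p" using surj by (metis imageE)
  have hom: "h x = x \<odot>\<^bsub>W\<^esub> h p" if "x \<in> ?P" for x
  proof -
    have "h (x \<otimes> p) = x \<odot>\<^bsub>W\<^esub> h p"
      using h Pp(1)[OF that] pP by (simp add: left_module_hom_def left_ideal_module_def)
    then show ?thesis using Pp(2)[OF that] by simp
  qed
  show "\<exists>h'\<in>left_module_hom R (left_ideal_module R ?P) V.
      \<forall>x\<in>carrier (left_ideal_module R ?P). g (h' x) = h x"
  proof (intro bexI[of _ "\<lambda>x. x \<odot>\<^bsub>V\<^esub> v"] ballI)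
    fix x assume "x \<in> carrier (left_ideal_module R ?P)"
    then have x: "x \<in> ?P" by (simp add: left_ideal_module_def)
    have "g (x \<odot>\<^bsub>V\<^esub> v) = x \<odot>\<^bsub>W\<^esub> g v"
      using g v(1) Pp(1)[OF x] by (simp add: left_module_hom_def)
    then show "g (x \<odot>\<^bsub>V\<^esub> v) = h x" using v(2) hom[OF x] by simp
  next
    show "(\<lambda>x. x \<odot>\<^bsub>V\<^esub> v) \<in> left_module_hom R (left_ideal_module R ?P) V"
      unfolding left_module_hom_def
      using v(1) Pp(1) by (simp add: left_ideal_module_def V.smult_closed V.smult_l_distr V.smult_assoc)
  qed
qed

end

section \<open>Lifting idempotents along a retraction onto a corner\<close>

text \<open>The situation of \<open>R = KM\<close> and \<open>S = KG\<^sub>e\<close>. The ring \<open>S\<close> shares the operations of \<open>R\<close> but has its own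
  identity, so it need not be a subring. The equation \<open>\<eta> x \<eta> = \<phi> x \<eta>\<close> says that \<open>s \<mapsto> s \<eta>\<close> maps \<open>S\<close> onto
  the corner \<open>\<eta> R \<eta>\<close>; it is an isomorphism with inverse \<open>\<phi>\<close>.\<close>

locale corner_retraction = R?: ring R + S: ring S
  for R :: "('r, 'x) ring_scheme" (structure) and S :: "('r, 'y) ring_scheme" +
  fixes \<phi> :: "'r \<Rightarrow> 'r" and \<eta> :: 'r
  assumes subset: "carrier S \<subseteq> carrier R"
    and mult_eq: "monoid.mult S = monoid.mult R"
    and add_eq: "ring.add S = ring.add R"
    and zero_eq: "\<zero>\<^bsub>S\<^esub> = \<zero>"
    and hom: "\<phi> \<in> ring_hom R S"
    and retract: "x \<in> carrier S \<Longrightarrow> \<phi> x = x"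
    and eta_closed: "\<eta> \<in> carrier R"
    and hom_eta: "\<phi> \<eta> = \<one>\<^bsub>S\<^esub>"
    and one_eta: "\<one>\<^bsub>S\<^esub> \<otimes> \<eta> = \<eta>"
    and sandwich: "x \<in> carrier R \<Longrightarrow> \<eta> \<otimes> x \<otimes> \<eta> = \<phi> x \<otimes> \<eta>"
begin

lemma inR: "x \<in> carrier S \<Longrightarrow> x \<in> carrier R"
  using subset by blast

lemma hom_closed: "x \<in> carrier R \<Longrightarrow> \<phi> x \<in> carrier S"
  using hom by (rule ring_hom_closed)

lemma hom_mult: "x \<in> carrier R \<Longrightarrow> y \<in> carrier R \<Longrightarrow> \<phi> (x \<otimes> y) = \<phi> x \<otimes> \<phi> y"
  using ring_hom_mult[OF hom] by (simp add: mult_eq)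

lemma hom_add: "x \<in> carrier R \<Longrightarrow> y \<in> carrier R \<Longrightarrow> \<phi> (x \<oplus> y) = \<phi> x \<oplus> \<phi> y"
  using ring_hom_add[OF hom] by (simp add: add_eq)

lemma S_closed: "x \<in> carrier S \<Longrightarrow> y \<in> carrier S \<Longrightarrow> x \<otimes> y \<in> carrier S"
  using S.m_closed by (simp add: mult_eq)

lemma S_one: "x \<in> carrier S \<Longrightarrow> x \<otimes> \<one>\<^bsub>S\<^esub> = x" "x \<in> carrier S \<Longrightarrow> \<one>\<^bsub>S\<^esub> \<otimes> x = x"
  using S.l_one S.r_one by (simp_all add: mult_eq)

lemma lift_eq: "s \<in> carrier S \<Longrightarrow> \<eta> \<otimes> s \<otimes> \<eta> = s \<otimes> \<eta>"
  using sandwich inR retract by simp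

lemma eta_idempotent: "\<eta> \<otimes> \<eta> = \<eta>"
  using lift_eq[OF S.one_closed] eta_closed one_eta inR[OF S.one_closed] by (simp add: m_assoc)

lemma hom_lift: "s \<in> carrier S \<Longrightarrow> \<phi> (s \<otimes> \<eta>) = s"
  using inR eta_closed by (simp add: hom_mult hom_eta retract S_one)

lemma lift_closed: "s \<in> carrier S \<Longrightarrow> s \<otimes> \<eta> \<in> carrier R"
  using inR eta_closed by simp

lemma lift_mult:
  assumes "s \<in> carrier S" "t \<in> carrier S"
  shows "(s \<otimes> \<eta>) \<otimes> (t \<otimes> \<eta>) = (s \<otimes> t) \<otimes> \<eta>"
proof -
  have "(s \<otimes> \<eta>) \<otimes> (t \<otimes> \<eta>) = s \<otimes> (\<eta> \<otimes> t \<otimes> \<eta>)"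
    using assms inR eta_closed by (simp add: m_assoc)
  also have "\<dots> = (s \<otimes> t) \<otimes> \<eta>"
    unfolding lift_eq[OF assms(2)] using assms inR eta_closed by (simp add: m_assoc)
  finally show ?thesis .
qed

lemma lift_absorb: "s \<in> carrier S \<Longrightarrow> \<eta> \<otimes> (s \<otimes> \<eta>) = s \<otimes> \<eta>" "s \<in> carrier S \<Longrightarrow> (s \<otimes> \<eta>) \<otimes> \<eta> = s \<otimes> \<eta>"
  using lift_eq inR eta_closed eta_idempotent by (simp_all add: m_assoc)

text \<open>On \<open>\<eta> R \<eta>\<close> the map \<open>\<phi>\<close> is injective, with inverse \<open>s \<mapsto> s \<eta>\<close>, so a decomposition of a lifted
  idempotent is determined by its image under \<open>\<phi>\<close>.\<close>

lemma primitive_idempotent_lift: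
  assumes t: "primitive_idempotent S t"
  shows "primitive_idempotent R (t \<otimes> \<eta>)"
proof -
  let ?g = "t \<otimes> \<eta>"
  have tS: "t \<in> carrier S" "t \<otimes> t = t" "t \<noteq> \<zero>"
    using t by (auto simp: primitive_idempotent_def idempotent_element_def mult_eq zero_eq)
  have zero: "\<phi> \<zero> = \<zero>" using retract[OF S.zero_closed] by (simp add: zero_eq)
  have gR: "?g \<in> carrier R" "?g \<otimes> ?g = ?g" using tS by (simp_all add: lift_closed lift_mult)
  have "?g \<noteq> \<zero>" using hom_lift[OF tS(1)] tS(3) zero by auto
  moreover have "a = \<zero> \<or> b = \<zero>"
    if a: "idempotent_element R a" and b: "idempotent_element R b" and ab: "orthogonal_elements R a b"
      and g: "?g = a \<oplus> b" for a b
  proof -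
    have aR: "a \<in> carrier R" "a \<otimes> a = a" and bR: "b \<in> carrier R" "b \<otimes> b = b"
      and ab: "a \<otimes> b = \<zero>" "b \<otimes> a = \<zero>"
      using a b ab by (auto simp: idempotent_element_def orthogonal_elements_def)
    have inner: "c = \<phi> c \<otimes> \<eta>" if c: "c \<in> carrier R" "?g \<otimes> c = c" "c \<otimes> ?g = c" for c
    proof -
      have l: "\<eta> \<otimes> c = c"
        using c(2) lift_absorb(1)[OF tS(1)] m_assoc[OF eta_closed gR(1) c(1)] by simp
      have r: "c \<otimes> \<eta> = c"
        using c(3) lift_absorb(2)[OF tS(1)] m_assoc[OF c(1) gR(1) eta_closed] by simp
      show ?thesis using sandwich[OF c(1)] l r by simp
    qed
    have a': "a = \<phi> a \<otimes> \<eta>"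
      by (rule inner) (use g aR bR ab in \<open>simp_all add: l_distr r_distr\<close>)
    have b': "b = \<phi> b \<otimes> \<eta>"
      by (rule inner) (use g aR bR ab in \<open>simp_all add: l_distr r_distr\<close>)
    have "t = \<phi> (a \<oplus> b)" using hom_lift[OF tS(1)] g by simp
    then have "t = \<phi> a \<oplus> \<phi> b" using aR bR by (simp add: hom_add)
    moreover have "\<phi> a \<otimes> \<phi> a = \<phi> a" "\<phi> b \<otimes> \<phi> b = \<phi> b" "\<phi> a \<otimes> \<phi> b = \<zero>" "\<phi> b \<otimes> \<phi> a = \<zero>"
      using aR bR ab zero by (simp_all flip: hom_mult)
    ultimately have "\<phi> a = \<zero> \<or> \<phi> b = \<zero>"
      using t hom_closed[OF aR(1)] hom_closed[OF bR(1)]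
      unfolding primitive_idempotent_def idempotent_element_def orthogonal_elements_def
        mult_eq add_eq zero_eq by blast
    then show ?thesis
    proof
      assume 0: "\<phi> a = \<zero>"
      have "a = \<zero>" by (subst a') (simp add: 0 eta_closed)
      then show ?thesis ..
    next
      assume 0: "\<phi> b = \<zero>"
      have "b = \<zero>" by (subst b') (simp add: 0 eta_closed)
      then show ?thesis ..
    qed
  qed
  ultimately show ?thesis
    using gR unfolding primitive_idempotent_def idempotent_element_def by blast
qed

text \<open>The covering map is \<open>\<phi>\<close> followed by the quotient map. Its kernel is superfluous: suppose
  \<open>g = t \<eta>\<close> is a sum of \<open>n\<close> in the kernel and \<open>l\<close> in a submodule \<open>L\<close>. Then \<open>\<phi> n = j t\<close> for some \<open>j\<close> in the
  radical of \<open>S\<close>, and any \<open>u\<close> with \<open>u (1 - t j) = 1\<close> satisfies \<open>u g l = g\<close>, whence \<open>g \<in> L\<close>.\<close>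

lemma projective_cover_lift:
  assumes t: "idempotent_element S t"
  shows "\<exists>\<pi>. projective_cover A B R
    (left_ideal_module R (right_translate R (carrier R) (t \<otimes> \<eta>)))
    (restrict_scalars \<phi> (quotient_module
      (left_ideal_module S (right_translate S (carrier S) t))
      (right_translate S (jacobson_radical S) t))) \<pi>"
proof -
  let ?g = "t \<otimes> \<eta>"
  let ?P = "right_translate R (carrier R) ?g"
  let ?T = "right_translate S (carrier S) t" and ?J = "right_translate S (jacobson_radical S) t"
  let ?V = "left_ideal_module S ?T"
  let ?Q = "quotient_module ?V ?J"
  have tS: "t \<in> carrier S" "t \<otimes> t = t" using t by (auto simp: idempotent_element_def mult_eq)
  have gR: "?g \<in> carrier R" "?g \<otimes> ?g = ?g" using tS by (simp_all add: lift_closed lift_mult)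
  have PI: "left_ideal ?P R" by (rule R.left_ideal_right_translate[OF R.left_ideal_carrier gR(1)])
  have TI: "left_ideal ?T S" by (rule S.left_ideal_right_translate[OF S.left_ideal_carrier tS(1)])
  have JI: "left_ideal ?J S"
    by (rule S.left_ideal_right_translate[OF S.left_ideal_jacobson_radical tS(1)])
  interpret V: left_module S ?V by (rule S.left_module_left_ideal[OF TI])
  interpret P: left_module R "left_ideal_module R ?P" by (rule R.left_module_left_ideal[OF PI])
  have J: "submodule ?J S ?V"
    unfolding S.submodule_left_ideal_iff[OF TI]
    using JI by (auto simp: right_translate_def jacobson_radical_def)
  have Vops: "carrier ?V = ?T" "\<And>x y. x \<oplus>\<^bsub>?V\<^esub> y = x \<oplus> y" "\<And>x y. x \<odot>\<^bsub>?V\<^esub> y = x \<otimes> y"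
    by (simp_all add: left_ideal_module_def add_eq mult_eq)
  have Pops: "carrier (left_ideal_module R ?P) = ?P"
      "\<And>x y. x \<oplus>\<^bsub>left_ideal_module R ?P\<^esub> y = x \<oplus> y"
      "\<And>x y. x \<odot>\<^bsub>left_ideal_module R ?P\<^esub> y = x \<otimes> y"
    by (simp_all add: left_ideal_module_def)
  have rops: "carrier (restrict_scalars \<phi> ?Q) = carrier ?Q"
      "\<And>x y. x \<oplus>\<^bsub>restrict_scalars \<phi> ?Q\<^esub> y = x \<oplus>\<^bsub>?Q\<^esub> y"
      "\<And>x y. x \<odot>\<^bsub>restrict_scalars \<phi> ?Q\<^esub> y = \<phi> x \<odot>\<^bsub>?Q\<^esub> y"
      "\<zero>\<^bsub>restrict_scalars \<phi> ?Q\<^esub> = ?J"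
    by (simp_all add: restrict_scalars_def quotient_module_def)
  have gP: "?g \<in> ?P"
    unfolding right_translate_def using gR by (intro image_eqI[of _ _ \<one>]) auto
  have Pg: "p \<in> carrier R" "p \<otimes> ?g = p" if "p \<in> ?P" for p
    using that gR by (auto simp: right_translate_def m_assoc)
  have phiP: "\<phi> p \<in> ?T" if "p \<in> ?P" for p
  proof -
    have "\<phi> p = \<phi> (p \<otimes> ?g)" using Pg(2)[OF that] by simp
    also have "\<dots> = \<phi> p \<otimes> t" using Pg(1)[OF that] gR by (simp add: hom_mult hom_lift tS)
    finally show ?thesis
      unfolding right_translate_def mult_eq using hom_closed[OF Pg(1)[OF that]] by (rule image_eqI)
  qed
  let ?pi = "\<lambda>p. ?J +>\<^bsub>?V\<^esub> \<phi> p"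
  have "?pi \<in> left_module_hom R (left_ideal_module R ?P) (restrict_scalars \<phi> ?Q)"
    unfolding left_module_hom_def
  proof (intro CollectI conjI ballI Pi_I)
    fix p assume "p \<in> carrier (left_ideal_module R ?P)"
    then have p: "p \<in> ?P" by (simp add: Pops)
    then show "?pi p \<in> carrier (restrict_scalars \<phi> ?Q)"
      using phiP by (auto simp: rops V.quotient_carrier Vops)
    {
      fix q assume "q \<in> carrier (left_ideal_module R ?P)"
      then have q: "q \<in> ?P" by (simp add: Pops)
      show "?pi (p \<oplus>\<^bsub>left_ideal_module R ?P\<^esub> q) = ?pi p \<oplus>\<^bsub>restrict_scalars \<phi> ?Q\<^esub> ?pi q"
        using V.quotient_add_coset[OF J, of "\<phi> p" "\<phi> q"] phiP[OF p] phiP[OF q] Pg p q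
        by (simp add: rops Pops Vops hom_add)
    }
    fix a assume a: "a \<in> carrier R"
    show "?pi (a \<odot>\<^bsub>left_ideal_module R ?P\<^esub> p) = a \<odot>\<^bsub>restrict_scalars \<phi> ?Q\<^esub> ?pi p"
      using V.quotient_smult_coset[OF J, of "\<phi> a" "\<phi> p"] phiP[OF p] Pg p a hom_closed[OF a]
      by (simp add: rops Pops Vops hom_mult)
  qed
  moreover have "?pi ` carrier (left_ideal_module R ?P) = carrier (restrict_scalars \<phi> ?Q)"
  proof
    show "?pi ` carrier (left_ideal_module R ?P) \<subseteq> carrier (restrict_scalars \<phi> ?Q)"
      using phiP by (auto simp: rops Pops V.quotient_carrier Vops)
    show "carrier (restrict_scalars \<phi> ?Q) \<subseteq> ?pi ` carrier (left_ideal_module R ?P)"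
    proof
      fix C assume "C \<in> carrier (restrict_scalars \<phi> ?Q)"
      then have "C \<in> (\<lambda>v. ?J +>\<^bsub>?V\<^esub> v) ` ?T" unfolding rops V.quotient_carrier Vops .
      then obtain v where v: "v \<in> ?T" "C = ?J +>\<^bsub>?V\<^esub> v" by (elim imageE)
      obtain s where s: "s \<in> carrier S" "v = s \<otimes> t"
        using v(1) unfolding right_translate_def mult_eq by (elim imageE)
      have "s \<otimes> ?g \<in> ?P" unfolding right_translate_def using inR[OF s(1)] by simp
      moreover have "\<phi> (s \<otimes> ?g) = s \<otimes> t"
        using s inR gR by (simp add: hom_mult retract hom_lift tS)
      ultimately show "C \<in> ?pi ` carrier (left_ideal_module R ?P)"
        unfolding Pops using v(2) s(2) by (intro image_eqI[of _ _ "s \<otimes> ?g"]) simp_all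
    qed
  qed
  moreover have "superfluous_submodule R (left_ideal_module R ?P)
      {p \<in> carrier (left_ideal_module R ?P). ?pi p = \<zero>\<^bsub>restrict_scalars \<phi> ?Q\<^esub>}"
    (is "superfluous_submodule R _ ?N")
  proof -
    have N: "?N = {p \<in> ?P. \<phi> p \<in> ?J}"
      using V.coset_eq_zero_iff[OF J] phiP by (auto simp: rops Pops Vops)
    have JS: "\<zero> \<in> ?J" "\<And>x y. x \<in> ?J \<Longrightarrow> y \<in> ?J \<Longrightarrow> x \<oplus> y \<in> ?J"
      "\<And>a x. a \<in> carrier S \<Longrightarrow> x \<in> ?J \<Longrightarrow> a \<otimes> x \<in> ?J"
      using JI by (auto simp: S.left_ideal_iff zero_eq add_eq mult_eq)
    have zero: "\<phi> \<zero> = \<zero>" using retract[OF S.zero_closed] by (simp add: zero_eq)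
    have PC: "\<zero> \<in> ?P" "\<And>x y. x \<in> ?P \<Longrightarrow> y \<in> ?P \<Longrightarrow> x \<oplus> y \<in> ?P"
      "\<And>a x. a \<in> carrier R \<Longrightarrow> x \<in> ?P \<Longrightarrow> a \<otimes> x \<in> ?P"
      using PI by (auto simp: R.left_ideal_iff)
    have "left_ideal ?N R"
      unfolding N R.left_ideal_iff
    proof (intro conjI ballI)
      show "{p \<in> ?P. \<phi> p \<in> ?J} \<subseteq> carrier R" using Pg by blast
      show "\<zero> \<in> {p \<in> ?P. \<phi> p \<in> ?J}" using PC(1) JS(1) zero by simp
      fix x assume x: "x \<in> {p \<in> ?P. \<phi> p \<in> ?J}"
      then have xR: "x \<in> carrier R" using Pg by blast
      { fix y assume y: "y \<in> {p \<in> ?P. \<phi> p \<in> ?J}"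
        then have "y \<in> carrier R" using Pg by blast
        then show "x \<oplus> y \<in> {p \<in> ?P. \<phi> p \<in> ?J}" using x y xR PC(2) JS(2) by (simp add: hom_add) }
      fix a assume a: "a \<in> carrier R"
      then show "a \<otimes> x \<in> {p \<in> ?P. \<phi> p \<in> ?J}"
        using x xR PC(3) JS(3) hom_closed by (simp add: hom_mult)
    qed
    then have "submodule ?N R (left_ideal_module R ?P)"
      unfolding R.submodule_left_ideal_iff[OF PI] unfolding N by auto
    moreover have "L = carrier (left_ideal_module R ?P)"
      if L: "submodule L R (left_ideal_module R ?P)"
        and sum: "?N <+>\<^bsub>left_ideal_module R ?P\<^esub> L = carrier (left_ideal_module R ?P)" for L
    proof -
      have LI: "left_ideal L R" "L \<subseteq> ?P" using L R.submodule_left_ideal_iff[OF PI] by auto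
      have "?g \<in> ?N <+>\<^bsub>left_ideal_module R ?P\<^esub> L" unfolding sum by (simp only: Pops gP)
      then obtain n l where nl: "n \<in> ?N" "l \<in> L" "?g = n \<oplus> l"
        unfolding set_add_def set_mult_def by (auto simp: left_ideal_module_def)
      then have n: "n \<in> ?P" "\<phi> n \<in> ?J" unfolding N by auto
      have nR: "n \<in> carrier R" and lR: "l \<in> carrier R" using Pg n(1) LI(2) nl(2) by auto
      obtain j where j: "j \<in> jacobson_radical S" "\<phi> n = j \<otimes> t"
        using n(2) unfolding right_translate_def mult_eq by (elim imageE)
      have jS: "j \<in> carrier S" using j(1) by (simp add: jacobson_radical_def)
      have tj: "t \<otimes> j \<in> jacobson_radical S"
        using S.left_ideal_jacobson_radical j(1) tS(1) unfolding S.left_ideal_iff mult_eq by blast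
      obtain u where u: "u \<in> carrier S" "u \<otimes>\<^bsub>S\<^esub> (\<one>\<^bsub>S\<^esub> \<ominus>\<^bsub>S\<^esub> t \<otimes> j) = \<one>\<^bsub>S\<^esub>"
        using S.jacobson_radical_left_inverse[OF tj] by blast
      have tjS: "t \<otimes> j \<in> carrier S" using tS jS by (simp add: S_closed)
      \<comment> \<open>The equation for \<open>u\<close>, rearranged so that no subtraction occurs.\<close>
      have "u = \<one>\<^bsub>S\<^esub> \<oplus>\<^bsub>S\<^esub> u \<otimes>\<^bsub>S\<^esub> (t \<otimes> j)"
      proof -
        have "u \<otimes>\<^bsub>S\<^esub> (\<one>\<^bsub>S\<^esub> \<ominus>\<^bsub>S\<^esub> t \<otimes> j) \<oplus>\<^bsub>S\<^esub> u \<otimes>\<^bsub>S\<^esub> (t \<otimes> j) = u"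
          using u(1) tjS
          by (simp add: S.minus_eq S.r_distr S.r_minus S.a_assoc S.l_neg)
        then show ?thesis using u(2) by simp
      qed
      then have ueq: "u = \<one>\<^bsub>S\<^esub> \<oplus> u \<otimes> (t \<otimes> j)" by (simp add: add_eq mult_eq)
      have uR: "u \<in> carrier R" "t \<in> carrier R" "j \<in> carrier R" "\<one>\<^bsub>S\<^esub> \<in> carrier R"
        using u(1) tS jS inR by auto
      have gn: "?g \<otimes> n = (t \<otimes> j) \<otimes> ?g"
      proof -
        have "?g \<otimes> n = ?g \<otimes> (n \<otimes> ?g)" using Pg(2)[OF n(1)] by simp
        also have "\<dots> = t \<otimes> (\<eta> \<otimes> (n \<otimes> t) \<otimes> \<eta>)" using uR nR eta_closed by (simp add: m_assoc)
        also have "\<dots> = t \<otimes> (\<phi> n \<otimes> t \<otimes> \<eta>)"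
          using uR nR eta_closed tS by (simp add: sandwich hom_mult retract)
        also have "\<dots> = (t \<otimes> j) \<otimes> (t \<otimes> t) \<otimes> \<eta>"
          unfolding j(2) using uR eta_closed by (simp add: m_assoc)
        also have "\<dots> = (t \<otimes> j) \<otimes> ?g" unfolding tS(2) using uR eta_closed by (simp add: m_assoc)
        finally show ?thesis .
      qed
      have "u \<otimes> ?g = ?g \<oplus> u \<otimes> (?g \<otimes> n)"
      proof -
        have "u \<otimes> ?g = (\<one>\<^bsub>S\<^esub> \<oplus> u \<otimes> (t \<otimes> j)) \<otimes> ?g" using ueq by simp
        also have "\<dots> = \<one>\<^bsub>S\<^esub> \<otimes> ?g \<oplus> u \<otimes> ((t \<otimes> j) \<otimes> ?g)"
          using uR gR(1) by (simp add: l_distr m_assoc)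
        also have "\<one>\<^bsub>S\<^esub> \<otimes> ?g = ?g"
          using uR eta_closed S_one(2)[OF tS(1)] by (simp flip: m_assoc)
        finally show ?thesis unfolding gn .
      qed
      moreover have "u \<otimes> ?g = u \<otimes> (?g \<otimes> l) \<oplus> u \<otimes> (?g \<otimes> n)"
      proof -
        have "u \<otimes> ?g = u \<otimes> (?g \<otimes> (n \<oplus> l))" using gR(2) nl(3) by simp
        then show ?thesis using uR gR(1) nR lR by (simp add: r_distr a_comm del: m_assoc)
      qed
      ultimately have "?g = u \<otimes> (?g \<otimes> l)"
        using uR gR(1) nR lR R.add.right_cancel[of "u \<otimes> (?g \<otimes> n)" ?g "u \<otimes> (?g \<otimes> l)"] by simp
      moreover have "u \<otimes> (?g \<otimes> l) \<in> L"
        using LI(1) nl(2) uR(1) gR(1) unfolding R.left_ideal_iff by blast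
      ultimately have "?g \<in> L" by simp
      then have "?P \<subseteq> L" using LI(1) unfolding right_translate_def R.left_ideal_iff by blast
      then show ?thesis using LI(2) Pops(1) by blast
    qed
    ultimately show ?thesis unfolding superfluous_submodule_def by blast
  qed
  moreover have "left_module R (restrict_scalars \<phi> ?Q)"
    by (rule left_module_restrict_scalars[OF R.ring_axioms hom V.left_module_quotient[OF J]])
  moreover have "projective_module A B R (left_ideal_module R ?P)"
    using gR by (intro R.projective_module_idempotent) (simp add: idempotent_element_def)
  ultimately show ?thesis unfolding projective_cover_def by blast
qed

end

section \<open>The algebra of a finite monoid\<close>

notation convolution (infixl \<open>\<star>\<close> 70)

lemma convolution_eq:
  "(f \<star> g) m = (\<Sum>a\<in>UNIV. \<Sum>b\<in>UNIV. if a * b = m then f a * g b else 0)"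
proof -
  have "(f \<star> g) m = (\<Sum>p\<in>{p \<in> UNIV. fst p * snd p = m}. f (fst p) * g (snd p))"
    unfolding convolution_def by (rule sum.cong) auto
  also have "\<dots> = (\<Sum>p\<in>UNIV. if fst p * snd p = m then f (fst p) * g (snd p) else 0)"
    by (rule sum.inter_filter) simp
  also have "\<dots> = (\<Sum>(a, b)\<in>UNIV \<times> UNIV. if a * b = m then f a * g b else 0)"
    by (rule sum.cong) auto
  finally show ?thesis by (simp only: sum.cartesian_product)
qed

text \<open>Elements of the algebra are treated as vectors from here on; evaluating sums of functions pointwise
  would break them up.\<close>

lemmas pointwise = plus_fun_apply zero_fun_apply
declare pointwise [simp del]

definition scale :: "'k::field \<Rightarrow> ('m \<Rightarrow> 'k) \<Rightarrow> 'm \<Rightarrow> 'k" where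
  "scale c f = (\<lambda>m. c * f m)"

interpretation function_space: vector_space scale
  by unfold_locales (auto simp: scale_def fun_eq_iff pointwise algebra_simps)

lemma convolution_add_left: "(f + g) \<star> h = f \<star> h + g \<star> h"
  by (rule ext) (auto simp: convolution_eq pointwise distrib_right simp flip: sum.distrib intro!: sum.cong)

lemma convolution_add_right: "h \<star> (f + g) = h \<star> f + h \<star> g"
  by (rule ext) (auto simp: convolution_eq pointwise distrib_left simp flip: sum.distrib intro!: sum.cong)

lemma convolution_scale_left: "scale c f \<star> g = scale c (f \<star> g)"
  by (rule ext) (simp add: convolution_eq scale_def sum_distrib_left if_distrib mult.assoc cong: if_cong)

lemma convolution_scale_right: "f \<star> scale c g = scale c (f \<star> g)"
  by (rule ext) (simp add: convolution_eq scale_def sum_distrib_left if_distrib mult.left_commute cong: if_cong)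

lemma convolution_zero [simp]: "0 \<star> f = 0" "f \<star> 0 = 0"
  by (auto simp: fun_eq_iff convolution_eq pointwise cong: if_cong)

lemma convolution_diff_left: "(f - g) \<star> h = f \<star> h - g \<star> h"
  using convolution_add_left[of "f - g" g h] by (simp add: algebra_simps)

lemma convolution_diff_right: "h \<star> (f - g) = h \<star> f - h \<star> g"
  using convolution_add_right[of h "f - g" g] by (simp add: algebra_simps)

lemma convolution_sum_left: "sum f A \<star> h = (\<Sum>a\<in>A. f a \<star> h)"
  by (induction A rule: infinite_finite_induct) (simp_all add: convolution_add_left)

lemma convolution_sum_right: "h \<star> sum f A = (\<Sum>a\<in>A. h \<star> f a)"
  by (induction A rule: infinite_finite_induct) (simp_all add: convolution_add_right)

lemma convolution_basis:
  "basis_element a \<star> basis_element b = (basis_element (a * b) :: 'm::{finite, monoid_mult} \<Rightarrow> 'k::field)"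
proof
  fix m
  let ?\<delta> = "basis_element :: 'm \<Rightarrow> 'm \<Rightarrow> 'k"
  have "(\<Sum>y\<in>UNIV. if x * y = m then ?\<delta> a x * ?\<delta> b y else 0) =
      (if x = a then if a * b = m then 1 else 0 else 0)" for x
  proof (cases "x = a")
    case True
    have "(\<Sum>y\<in>UNIV. if x * y = m then ?\<delta> a x * ?\<delta> b y else 0) =
        (\<Sum>y\<in>UNIV. if y = b then if a * b = m then 1 else 0 else 0)"
      by (rule sum.cong) (auto simp: True basis_element_def)
    then show ?thesis using True by simp
  next
    case False
    then show ?thesis by (simp add: basis_element_def cong: if_cong)
  qed
  then show "(?\<delta> a \<star> ?\<delta> b) m = ?\<delta> (a * b) m"
    unfolding convolution_eq by (auto simp: basis_element_def)
qed

lemma sum_apply: "sum f A x = (\<Sum>a\<in>A. f a x)" for f :: "'i \<Rightarrow> 'm \<Rightarrow> 'k::field"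
  by (induction A rule: infinite_finite_induct) (simp_all add: pointwise)

lemma basis_expansion:
  fixes f :: "'m::finite \<Rightarrow> 'k::field"
  assumes "\<forall>m. m \<notin> A \<longrightarrow> f m = 0"
  shows "f = (\<Sum>m\<in>A. scale (f m) (basis_element m))"
proof
  fix x
  have "(\<Sum>m\<in>A. scale (f m) (basis_element m)) x = (\<Sum>m\<in>A. if m = x then f m else 0)"
    unfolding sum_apply scale_def basis_element_def by (intro sum.cong) auto
  also have "\<dots> = (if x \<in> A then f x else 0)" by simp
  finally show "f x = (\<Sum>m\<in>A. scale (f m) (basis_element m)) x"
    using assms by auto
qed

lemma linear_induct [consumes 1, case_names zero basis add scale]:
  fixes f :: "'m::finite \<Rightarrow> 'k::field"
  assumes supp: "\<forall>m. m \<notin> A \<longrightarrow> f m = 0"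
    and "P 0" and basis: "\<And>m. m \<in> A \<Longrightarrow> P (basis_element m)"
    and add: "\<And>f g. P f \<Longrightarrow> P g \<Longrightarrow> P (f + g)" and scale: "\<And>c f. P f \<Longrightarrow> P (scale c f)"
  shows "P f"
proof -
  have "finite A" by simp
  then have "P (\<Sum>m\<in>A. scale (f m) (basis_element m))"
    using basis by (induction A) (auto intro: \<open>P 0\<close> add scale)
  then show ?thesis by (subst basis_expansion[OF supp])
qed

lemmas linear_induct_UNIV = linear_induct[of UNIV, simplified, case_names zero basis add scale]

lemma convolution_assoc: "(f \<star> g) \<star> h = f \<star> (g \<star> h)"
proof (induction f rule: linear_induct_UNIV)
  case (basis a)
  show ?case
  proof (induction g rule: linear_induct_UNIV)
    case (basis b)
    show ?case
      by (induction h rule: linear_induct_UNIV)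
        (simp_all add: convolution_basis mult.assoc convolution_add_right convolution_scale_right)
  qed (simp_all add: convolution_add_left convolution_add_right convolution_scale_left convolution_scale_right)
qed (simp_all add: convolution_add_left convolution_scale_left)

lemma convolution_one: "basis_element 1 \<star> f = f" "f \<star> basis_element 1 = f"
  by (induction f rule: linear_induct_UNIV;
    simp add: convolution_basis convolution_add_left convolution_scale_left
      convolution_add_right convolution_scale_right)+

lemma monoid_algebra_simps:
  "carrier monoid_algebra = UNIV" "monoid.mult monoid_algebra = convolution"
  "\<one>\<^bsub>monoid_algebra\<^esub> = basis_element 1" "\<zero>\<^bsub>monoid_algebra\<^esub> = 0" "ring.add monoid_algebra = (+)"
  by (auto simp: monoid_algebra_def fun_eq_iff pointwise)

lemma group_algebra_simps:
  "carrier (group_algebra_at e) = {f. \<forall>m. m \<notin> corner_units e \<longrightarrow> f m = 0}"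
  "monoid.mult (group_algebra_at e) = convolution"
  "\<one>\<^bsub>group_algebra_at e\<^esub> = basis_element e" "\<zero>\<^bsub>group_algebra_at e\<^esub> = 0"
  "ring.add (group_algebra_at e) = (+)"
  by (auto simp: group_algebra_at_def monoid_algebra_def fun_eq_iff pointwise)

lemma ring_monoid_algebra: "ring (monoid_algebra :: ('m::{finite, monoid_mult} \<Rightarrow> 'k::field) ring)"
proof (rule ringI)
  show "abelian_group (monoid_algebra :: ('m \<Rightarrow> 'k) ring)"
    by (rule abelian_groupI) (auto simp: monoid_algebra_simps algebra_simps intro: exI[of _ "- x" for x])
  show "Group.monoid (monoid_algebra :: ('m \<Rightarrow> 'k) ring)"
    by (rule monoidI) (auto simp: monoid_algebra_simps convolution_assoc convolution_one)
qed (auto simp: monoid_algebra_simps convolution_add_left convolution_add_right)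

lemma finsum_pointwise:
  fixes f :: "'i \<Rightarrow> 'm \<Rightarrow> 'k::field"
  assumes "abelian_monoid R" "\<zero>\<^bsub>R\<^esub> = 0" "ring.add R = (+)"
    and "finite I" "\<And>i. i \<in> I \<Longrightarrow> f i \<in> carrier R"
  shows "finsum R f I = sum f I"
proof -
  interpret abelian_monoid R by fact
  from assms(4,5) show ?thesis
    by (induction I) (simp_all add: assms(2,3) Pi_def)
qed

section \<open>Finite monoids and their corners\<close>

lemma cornerD:
  assumes "e * e = e" "x \<in> corner e" shows "e * x = x" "x * e = x"
  using assms by (auto simp: corner_def mult.assoc) (metis mult.assoc)+

lemma cornerI: "e * x = x \<Longrightarrow> x * e = x \<Longrightarrow> x \<in> corner e"
  unfolding corner_def by (metis (mono_tags, lifting) mem_Collect_eq)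

lemma corner_closed:
  assumes "e * e = e" "x \<in> corner e" "y \<in> corner e" shows "x * y \<in> corner e"
  using cornerD[OF assms(1,2)] cornerD[OF assms(1,3)] by (metis cornerI mult.assoc)

text \<open>Left multiplication by a right inverse \<open>h\<close> of \<open>g\<close> is injective on the finite corner, hence
  surjective.\<close>

lemma corner_left_inverse:
  fixes e :: "'m::{finite, monoid_mult}"
  assumes e: "e * e = e" and g: "g \<in> corner e" and h: "h \<in> corner e" and gh: "g * h = e"
  shows "h * g = e"
proof -
  have "inj_on ((*) h) (corner e)"
    using cornerD[OF e] gh by (intro inj_onI) (metis mult.assoc)
  moreover have "(*) h ` corner e \<subseteq> corner e" using corner_closed[OF e h] by blast
  ultimately have "(*) h ` corner e = corner e" by (simp add: endo_inj_surj)
  moreover have "e \<in> corner e" using e by (intro cornerI)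
  ultimately obtain x where x: "x \<in> corner e" "h * x = e" by (metis imageE)
  have "x = g" using x gh cornerD[OF e x(1)] cornerD[OF e g] by (metis mult.assoc)
  then show ?thesis using x by simp
qed

lemma corner_unitsD:
  assumes "e * e = e" "g \<in> corner_units e" shows "g \<in> corner e" "e * g = g" "g * e = g"
  using assms cornerD by (auto simp: corner_units_def)

lemma corner_units_one: "e * e = e \<Longrightarrow> e \<in> corner_units e"
  unfolding corner_units_def using cornerI[of e e] by auto

text \<open>In a finite corner one-sided inverses are two-sided, so a factor of a unit is a unit.\<close>

lemma corner_units_mult_iff:
  fixes e :: "'m::{finite, monoid_mult}"
  assumes e: "e * e = e" and x: "x \<in> corner e" and y: "y \<in> corner e"
  shows "x * y \<in> corner_units e \<longleftrightarrow> x \<in> corner_units e \<and> y \<in> corner_units e"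
proof
  assume "x * y \<in> corner_units e"
  then obtain h where h: "h \<in> corner e" "(x * y) * h = e" "h * (x * y) = e"
    by (auto simp: corner_units_def)
  have "x * (y * h) = e" "(h * x) * y = e" using h by (simp_all add: mult.assoc)
  moreover have yh: "y * h \<in> corner e" "h * x \<in> corner e" using corner_closed[OF e] x y h by auto
  moreover have "(y * h) * x = e" "y * (h * x) = e"
    using corner_left_inverse[OF e x yh(1)] corner_left_inverse[OF e yh(2) y] calculation(1,2) by simp_all
  ultimately show "x \<in> corner_units e \<and> y \<in> corner_units e"
    unfolding corner_units_def using x y by blast
next
  assume "x \<in> corner_units e \<and> y \<in> corner_units e"
  then obtain x' y' where x': "x' \<in> corner e" "x * x' = e" "x' * x = e"
    and y': "y' \<in> corner e" "y * y' = e" "y' * y = e"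
    by (auto simp: corner_units_def)
  have "(x * y) * (y' * x') = x * (y * y') * x'" "(y' * x') * (x * y) = y' * (x' * x) * y"
    by (simp_all add: mult.assoc)
  then have "(x * y) * (y' * x') = e" "(y' * x') * (x * y) = e"
    using x' y' cornerD[OF e x] cornerD[OF e y'(1)] by simp_all
  then show "x * y \<in> corner_units e"
    unfolding corner_units_def using corner_closed[OF e] x y x'(1) y'(1) by blast
qed

lemma corner_units_idempotent:
  assumes e: "e * e = e" and g: "g \<in> corner_units e" "g * g = g" shows "g = e"
proof -
  obtain h where "h * g = e" using g by (auto simp: corner_units_def)
  then show ?thesis using g(2) corner_unitsD[OF e g(1)] by (metis mult.assoc)
qed

section \<open>Algebras of groups of units\<close>

lemma group_algebra_mult_closed:
  fixes f g :: "'m::{finite, monoid_mult} \<Rightarrow> 'k::field"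
  assumes e: "e * e = e" and f: "f \<in> carrier (group_algebra_at e)" and g: "g \<in> carrier (group_algebra_at e)"
  shows "f \<star> g \<in> carrier (group_algebra_at e)"
proof -
  have "(f \<star> g) m = 0" if m: "m \<notin> corner_units e" for m
  proof -
    have "f a * g b = 0" if "a * b = m" for a b
    proof (cases "a \<in> corner_units e \<and> b \<in> corner_units e")
      case True
      then have "m \<in> corner_units e"
        using corner_units_mult_iff[OF e] corner_unitsD(1)[OF e] \<open>a * b = m\<close> by blast
      then show ?thesis using m by simp
    next
      case False
      then show ?thesis using f g by (auto simp: group_algebra_simps)
    qed
    then show ?thesis unfolding convolution_eq by (intro sum.neutral ballI) simp
  qed
  then show ?thesis by (simp add: group_algebra_simps)
qed

lemma group_algebra_one:
  fixes f :: "'m::{finite, monoid_mult} \<Rightarrow> 'k::field"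
  assumes e: "e * e = e" and f: "f \<in> carrier (group_algebra_at e)"
  shows "basis_element e \<star> f = f" "f \<star> basis_element e = f"
proof -
  have "\<forall>m. m \<notin> corner_units e \<longrightarrow> f m = 0" using f by (simp add: group_algebra_simps)
  then show "basis_element e \<star> f = f"
    by (induction f rule: linear_induct)
      (simp_all add: convolution_basis corner_unitsD[OF e] convolution_add_right convolution_scale_right)
  have "\<forall>m. m \<notin> corner_units e \<longrightarrow> f m = 0" using f by (simp add: group_algebra_simps)
  then show "f \<star> basis_element e = f"
    by (induction f rule: linear_induct)
      (simp_all add: convolution_basis corner_unitsD[OF e] convolution_add_left convolution_scale_left)
qed

lemma ring_group_algebra:
  assumes e: "e * e = e"
  shows "ring (group_algebra_at e :: ('m::{finite, monoid_mult} \<Rightarrow> 'k::field) ring)"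
proof (rule ringI)
  show "abelian_group (group_algebra_at e :: ('m \<Rightarrow> 'k) ring)"
  proof (rule abelian_groupI)
    fix x :: "'m \<Rightarrow> 'k" assume "x \<in> carrier (group_algebra_at e)"
    then show "\<exists>y\<in>carrier (group_algebra_at e). y \<oplus>\<^bsub>group_algebra_at e\<^esub> x = \<zero>\<^bsub>group_algebra_at e\<^esub>"
      by (intro bexI[of _ "- x"]) (simp_all add: group_algebra_simps)
  qed (auto simp: group_algebra_simps pointwise algebra_simps)
  show "Group.monoid (group_algebra_at e :: ('m \<Rightarrow> 'k) ring)"
  proof (rule monoidI)
    fix x y :: "'m \<Rightarrow> 'k" assume "x \<in> carrier (group_algebra_at e)" "y \<in> carrier (group_algebra_at e)"
    then show "x \<otimes>\<^bsub>group_algebra_at e\<^esub> y \<in> carrier (group_algebra_at e)"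
      using group_algebra_mult_closed[OF e] by (simp add: group_algebra_simps(2))
  next
    have "basis_element e m = (0 :: 'k)" if "m \<notin> corner_units e" for m
      using that corner_units_one[OF e] by (auto simp: basis_element_def)
    then show "\<one>\<^bsub>group_algebra_at e\<^esub> \<in> carrier (group_algebra_at e :: ('m \<Rightarrow> 'k) ring)"
      by (simp add: group_algebra_simps)
  qed (simp_all add: group_algebra_simps(2,3) convolution_assoc group_algebra_one[OF e])
qed (auto simp: group_algebra_simps convolution_add_left convolution_add_right)

lemma span_basis_elements: "function_space.span (range basis_element) = (UNIV :: ('m::finite \<Rightarrow> 'k::field) set)"
proof -
  have "f \<in> function_space.span (range basis_element)" for f :: "'m \<Rightarrow> 'k"
    by (induction f rule: linear_induct_UNIV)
      (auto intro: function_space.span_zero function_space.span_base function_space.span_add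
        function_space.span_scale)
  then show ?thesis by auto
qed

text \<open>In a linear dependence between the powers of \<open>x\<close>, solve for the lowest power with a nonzero
  coefficient.\<close>

lemma strongly_pi_regular_group_algebra:
  assumes e: "e * e = e"
  shows "strongly_pi_regular (group_algebra_at e :: ('m::{finite, monoid_mult} \<Rightarrow> 'k::field) ring)"
  unfolding strongly_pi_regular_def
proof
  let ?S = "group_algebra_at e :: ('m \<Rightarrow> 'k) ring"
  fix x assume x: "x \<in> carrier ?S"
  interpret S: ring ?S by (rule ring_group_algebra[OF e])
  let ?p = "\<lambda>i::nat. x [^]\<^bsub>?S\<^esub> i"
  have p: "?p i \<in> carrier ?S" for i using x by simp
  have pmult: "?p i \<star> ?p j = ?p (i + j)" for i j
    using S.nat_pow_mult[OF x] by (simp add: group_algebra_simps(2))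
  have x1: "x = ?p 1" using x by simp
  show "\<exists>n. \<exists>w\<in>carrier ?S. x \<otimes>\<^bsub>?S\<^esub> w = w \<otimes>\<^bsub>?S\<^esub> x \<and> ?p n = ?p (Suc n) \<otimes>\<^bsub>?S\<^esub> w"
  proof (cases "inj ?p")
    case False
    then obtain i j where ij: "?p i = ?p j" "i < j"
      unfolding inj_def by (metis linorder_neqE_nat)
    have "x \<star> ?p (j - Suc i) = ?p (j - Suc i) \<star> x"
      by (subst (1 2) x1) (simp only: pmult add.commute)
    moreover have "?p i = ?p (Suc i) \<star> ?p (j - Suc i)" using ij by (simp only: pmult) simp
    ultimately show ?thesis using p unfolding group_algebra_simps(2) by blast
  next
    case True
    have "function_space.dependent (range ?p)"
    proof (rule ccontr)
      assume "function_space.independent (range ?p)"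
      then have "finite (range ?p)"
        using function_space.independent_span_bound[of "range basis_element" "range ?p"]
        by (simp add: span_basis_elements)
      then show False using True by (simp add: finite_image_iff)
    qed
    then obtain t u where t: "finite t" "t \<subseteq> range ?p" "(\<Sum>v\<in>t. scale (u v) v) = 0" "\<exists>v\<in>t. u v \<noteq> 0"
      unfolding function_space.dependent_explicit by blast
    define c where "c i = u (?p i)" for i
    define T where "T = {i. ?p i \<in> t \<and> c i \<noteq> 0}"
    have tT: "t = ?p ` (?p -` t)" using t(2) by blast
    have fin: "finite (?p -` t)" using t(1) True by (rule finite_vimageI)
    have T: "finite T" "T \<noteq> {}"
      using finite_subset[OF _ fin, of T] t(2,4) by (auto simp: T_def c_def)
    have "(\<Sum>i\<in>?p -` t. scale (c i) (?p i)) = (\<Sum>v\<in>?p ` (?p -` t). scale (u v) v)"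
      using True by (subst sum.reindex) (auto simp: c_def inj_on_def inj_def)
    also have "\<dots> = 0" using t(3) tT by simp
    finally have "(\<Sum>i\<in>?p -` t. scale (c i) (?p i)) = 0" .
    then have sum0: "(\<Sum>i\<in>T. scale (c i) (?p i)) = 0"
      by (subst (asm) sum.mono_neutral_right[OF fin, of T]) (auto simp: T_def)
    define n where "n = Min T"
    have n: "n \<in> T" "c n \<noteq> 0" "\<And>i. i \<in> T - {n} \<Longrightarrow> n < i"
      using T Min_in[OF T] Min_le[OF T(1)] by (auto simp: n_def T_def le_neq_implies_less)
    define w where "w = (\<Sum>i\<in>T - {n}. scale (- c i / c n) (?p (i - Suc n)))"
    have wS: "w \<in> carrier ?S"
    proof -
      have "scale a (?p i) \<in> carrier ?S" for a i using p[of i] by (simp add: group_algebra_simps scale_def)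
      then have "w m = 0" if "m \<notin> corner_units e" for m
        using that unfolding w_def by (subst sum_apply) (auto simp: group_algebra_simps intro!: sum.neutral)
      then show ?thesis by (simp add: group_algebra_simps)
    qed
    have xw: "x \<star> w = w \<star> x"
    proof -
      have "x \<star> ?p i = ?p i \<star> x" for i
        by (subst (1 2) x1) (simp only: pmult add.commute)
      then show ?thesis
        unfolding w_def by (simp add: convolution_sum_left convolution_sum_right
            convolution_scale_left convolution_scale_right del: function_space.scale_minus_left)
    qed
    have "?p n = ?p (Suc n) \<star> w"
    proof -
      have "?p (Suc n) \<star> w = (\<Sum>i\<in>T - {n}. scale (- c i / c n) (?p i))"
        unfolding w_def convolution_sum_right convolution_scale_right pmult
      proof (intro sum.cong refl)
        fix i assume "i \<in> T - {n}"
        then have "Suc n + (i - Suc n) = i" using n(3)[of i] by simp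
        then show "scale (- c i / c n) (?p (Suc n + (i - Suc n))) = scale (- c i / c n) (?p i)"
          by (simp only:)
      qed
      also have "\<dots> = scale (- 1 / c n) (\<Sum>i\<in>T - {n}. scale (c i) (?p i))"
        by (simp add: function_space.scale_sum_right)
      also have "(\<Sum>i\<in>T - {n}. scale (c i) (?p i)) = - scale (c n) (?p n)"
        using sum0 sum.remove[OF T(1) n(1), of "\<lambda>i. scale (c i) (?p i)"]
        by (simp add: eq_neg_iff_add_eq_0 add.commute)
      also have "scale (- 1 / c n) (- scale (c n) (?p n)) = ?p n"
        using n(2) by (simp add: scale_def fun_eq_iff)
      finally show ?thesis ..
    qed
    then show ?thesis using wS xw unfolding group_algebra_simps(2) by blast
  qed
qed

section \<open>Regular left duo monoids\<close>

locale regular_left_duo_monoid =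
  fixes M :: "'m::{finite, monoid_mult} itself"
  assumes regular: "regular_monoid M" and left_duo: "left_duo_monoid M"
begin

lemma left_duo_swap: obtains y where "m * x = y * (m :: 'm)"
proof -
  have "m * x \<in> {m * x |x. True}" by auto
  then have "m * x \<in> {x * m |x. True}" using left_duo unfolding left_duo_monoid_def by blast
  then show ?thesis using that by auto
qed

lemma idempotent_absorb_right: "e * x * e = e * x" if "e * e = e" for e x :: 'm
proof -
  obtain y where "e * x = y * e" by (rule left_duo_swap)
  then show ?thesis using that by (simp add: mult.assoc)
qed

lemma idempotents_mult_closed:
  assumes "e \<in> idempotents" "f \<in> idempotents" shows "e * f \<in> (idempotents :: 'm set)"
proof -
  have "e * f * (e * f) = e * f * e * f" by (simp add: mult.assoc)
  also have "\<dots> = e * f" using assms idempotent_absorb_right[of e f] by (simp add: idempotents_def mult.assoc)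
  finally show ?thesis by (simp add: idempotents_def)
qed

lemma corner_iff: "e * e = e \<Longrightarrow> x \<in> corner e \<longleftrightarrow> e * x = x" for e x :: 'm
  using cornerD cornerI idempotent_absorb_right by metis

text \<open>If \<open>m = m a m\<close>, then \<open>m\<close> is a unit in the corner at \<open>m a\<close>; its inverse is the part of \<open>a\<close> there.\<close>

lemma in_corner_units:
  fixes m :: 'm
  obtains f where "f \<in> idempotents" "m \<in> corner_units f"
proof -
  obtain a where a: "m * a * m = m" using regular unfolding regular_monoid_def by blast
  define f where "f = m * a"
  have f: "f * f = f" using a by (simp add: f_def mult.assoc [symmetric])
  have fm: "f * m = m" using a by (simp add: f_def)
  have mf: "m * f = m" using idempotent_absorb_right[OF f, of m] fm by simp
  define h where "h = f * a * f"
  have mC: "m \<in> corner f" and hC: "h \<in> corner f" using fm f by (simp_all add: corner_iff h_def mult.assoc [symmetric])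
  have "m * h = m * f * a * f" by (simp add: h_def mult.assoc)
  also have "\<dots> = f" using mf f by (simp add: f_def)
  finally have mh: "m * h = f" .
  moreover have "h * m = f" by (rule corner_left_inverse[OF f mC hC mh])
  ultimately have "m \<in> corner_units f" using mC hC by (auto simp: corner_units_def)
  then show ?thesis using that f by (simp add: idempotents_def)
qed

lemma principal_left_subset_iff:
  assumes "e \<in> idempotents" "f \<in> (idempotents :: 'm set)"
  shows "principal_left e \<subseteq> principal_left f \<longleftrightarrow> e * f = e"
proof
  assume "principal_left e \<subseteq> principal_left f"
  moreover have "e \<in> principal_left e" using assms by (auto simp: principal_left_def idempotents_def intro: exI[of _ e])
  ultimately obtain b where "e = b * f" by (auto simp: principal_left_def)
  then show "e * f = e" using assms by (simp add: idempotents_def mult.assoc)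
next
  assume ef: "e * f = e"
  show "principal_left e \<subseteq> principal_left f"
  proof
    fix x assume "x \<in> principal_left e"
    then obtain b where b: "b \<in> idempotents" "x = b * e" by (auto simp: principal_left_def)
    then have "x = (b * e) * f" using ef by (simp add: mult.assoc)
    moreover have "b * e \<in> idempotents" using b(1) assms by (intro idempotents_mult_closed)
    ultimately show "x \<in> principal_left f" by (auto simp: principal_left_def)
  qed
qed

lemma corner_projection_in_corner: "e * e = e \<Longrightarrow> e * m \<in> corner e" for e m :: 'm
  by (simp add: corner_iff flip: mult.assoc)

end

lemma corner_projection_linear:
  "corner_projection e (f + g) = corner_projection e f + corner_projection e g"
  "corner_projection e (scale c f) = scale c (corner_projection e f)"
  "corner_projection e 0 = 0"
  unfolding fun_eq_iff
  by (simp_all add: corner_projection_def pointwise scale_def algebra_simps sum.distrib sum_distrib_left)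

lemma corner_projection_diff: "corner_projection e (f - g) = corner_projection e f - corner_projection e g"
  using corner_projection_linear(1)[of e "f - g" g] by (simp add: algebra_simps)

lemma corner_projection_sum: "corner_projection e (sum f A) = (\<Sum>a\<in>A. corner_projection e (f a))"
  by (induction A rule: infinite_finite_induct) (simp_all add: corner_projection_linear)

lemma corner_projection_basis:
  "corner_projection e (basis_element m) =
    (if e * m \<in> corner_units e then basis_element (e * m) else 0)"
proof
  fix g
  have "corner_projection e (basis_element m) g =
      (\<Sum>x\<in>UNIV. if x = m then if e * x \<in> corner_units e then basis_element (e * x) g else 0 else 0)"
    unfolding corner_projection_def basis_element_def by (intro sum.cong) auto
  then show "corner_projection e (basis_element m) g =
      (if e * m \<in> corner_units e then basis_element (e * m) else 0) g"
    by (auto simp: pointwise)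
qed

lemma corner_projection_closed: "corner_projection e f \<in> carrier (group_algebra_at e)"
  unfolding group_algebra_simps corner_projection_def
  by (auto intro!: sum.neutral simp: basis_element_def)

lemma corner_projection_retract:
  assumes e: "e * e = e" and f: "f \<in> carrier (group_algebra_at e)"
  shows "corner_projection e f = f"
proof -
  have "\<forall>m. m \<notin> corner_units e \<longrightarrow> f m = 0" using f by (simp add: group_algebra_simps)
  then show ?thesis
    by (induction f rule: linear_induct)
      (simp_all add: corner_projection_linear corner_projection_basis corner_unitsD[OF e])
qed

text \<open>The linear map \<open>corner_projection e\<close> is multiplicative because a product of elements of a finite
  corner is a unit only if both factors are.\<close>

lemma (in regular_left_duo_monoid) corner_projection_mult:
  fixes f g :: "'m \<Rightarrow> 'k::field"
  assumes e: "e * e = e"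
  shows "corner_projection e (f \<star> g) = corner_projection e f \<star> corner_projection e g"
proof (induction f rule: linear_induct_UNIV)
  case (basis a)
  show ?case
  proof (induction g rule: linear_induct_UNIV)
    case (basis b)
    have ab: "e * (a * b) = (e * a) * (e * b)"
      using idempotent_absorb_right[OF e, of a] by (simp flip: mult.assoc)
    have "e * (a * b) \<in> corner_units e \<longleftrightarrow> e * a \<in> corner_units e \<and> e * b \<in> corner_units e"
      unfolding ab by (intro corner_units_mult_iff e corner_projection_in_corner)
    then show ?case by (auto simp: convolution_basis corner_projection_basis ab)
  qed (simp_all add: convolution_add_right convolution_scale_right corner_projection_linear)
qed (simp_all add: convolution_add_left convolution_scale_left corner_projection_linear)

section \<open>The idempotents of the band\<close>

locale transversal = regular_left_duo_monoid M
  for M :: "'m::{finite, monoid_mult} itself" +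
  fixes e :: "'m set \<Rightarrow> 'm"
  assumes transversal: "X \<in> left_ideal_poset \<Longrightarrow> e X \<in> idempotents \<and> X = principal_left (e X)"
begin

abbreviation \<Lambda> :: "'m set set" where "\<Lambda> \<equiv> left_ideal_poset"

lemma e_idem: "X \<in> \<Lambda> \<Longrightarrow> e X * e X = e X" "X \<in> \<Lambda> \<Longrightarrow> e X \<in> idempotents"
  using transversal by (auto simp: idempotents_def)

lemma subset_principal_iff: "X \<in> \<Lambda> \<Longrightarrow> b \<in> idempotents \<Longrightarrow> X \<subseteq> principal_left b \<longleftrightarrow> e X * b = e X"
  using transversal principal_left_subset_iff by metis

lemma principal_subset_iff: "X \<in> \<Lambda> \<Longrightarrow> b \<in> idempotents \<Longrightarrow> principal_left b \<subseteq> X \<longleftrightarrow> b * e X = b"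
  using transversal principal_left_subset_iff by metis

lemma subset_iff_e: "X \<in> \<Lambda> \<Longrightarrow> Y \<in> \<Lambda> \<Longrightarrow> X \<subseteq> Y \<longleftrightarrow> e X * e Y = e X"
  using transversal principal_left_subset_iff by metis

lemma principal_left_in_poset: "b \<in> idempotents \<Longrightarrow> principal_left b \<in> \<Lambda>"
  by (auto simp: left_ideal_poset_def)

lemma eta_eq:
  "eta e X = basis_element (e X) - (\<Sum>Y\<in>{Y \<in> \<Lambda>. Y \<subset> X}. basis_element (e X) \<star> eta e Y)"
  by (subst eta.simps) (auto simp: fun_eq_iff sum_apply)

lemma basis_eta: "X \<in> \<Lambda> \<Longrightarrow> basis_element (e X) \<star> eta e X = eta e X"
  by (subst (1 2) eta_eq)
    (simp add: convolution_diff_right convolution_sum_right convolution_basis e_idem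
      flip: convolution_assoc)

text \<open>Since \<open>b \<eta>\<^sub>X = b e\<^sub>X \<eta>\<^sub>X\<close>, one may replace \<open>b\<close> by \<open>a = b e\<^sub>X\<close>, which generates some \<open>Z \<subset> X\<close>. The
  terms \<open>a \<eta>\<^sub>Y\<close> of the recursion for \<open>\<eta>\<^sub>X\<close> with \<open>Y\<close> not below \<open>Z\<close> vanish by induction, and the remaining ones
  add up to \<open>a\<close> by the recursion for \<open>\<eta>\<^sub>Z\<close>.\<close>

lemma idempotent_eta_zero:
  assumes "X \<in> \<Lambda>" "b \<in> idempotents" "\<not> X \<subseteq> principal_left b"
  shows "basis_element b \<star> eta e X = (0 :: 'm \<Rightarrow> 'k::field)"
  using finite[of X] assms
proof (induction X arbitrary: b rule: finite_psubset_induct)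
  case (psubset X)
  let ?\<delta> = "basis_element :: 'm \<Rightarrow> 'm \<Rightarrow> 'k" and ?\<eta> = "eta e :: 'm set \<Rightarrow> 'm \<Rightarrow> 'k"
  note X = psubset.prems(1) and b = psubset.prems(2)
  define a where "a = b * e X"
  have a: "a \<in> idempotents" unfolding a_def by (intro idempotents_mult_closed b e_idem X)
  have aX: "a * e X = a" using e_idem[OF X] by (simp add: a_def mult.assoc)
  define Z where "Z = principal_left a"
  have Z: "Z \<in> \<Lambda>" unfolding Z_def by (rule principal_left_in_poset[OF a])
  have ZX: "Z \<subset> X"
  proof
    show "Z \<subseteq> X" unfolding Z_def using principal_subset_iff[OF X a] aX by simp
    show "Z \<noteq> X"
    proof
      assume "Z = X"
      then have "e X * a = e X" using subset_principal_iff[OF X a] by (simp add: Z_def)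
      then have "e X * b = e X"
        using idempotent_absorb_right[OF e_idem(1)[OF X], of b] by (simp add: a_def mult.assoc)
      then show False using psubset.prems(3) subset_principal_iff[OF X b] by simp
    qed
  qed
  have aZ: "a * e Z = a" using principal_subset_iff[OF Z a] by (simp add: Z_def)
  have recursion: "?\<delta> a \<star> ?\<eta> W = ?\<delta> a - (\<Sum>Y\<in>{Y \<in> \<Lambda>. Y \<subset> W}. ?\<delta> a \<star> ?\<eta> Y)" if "a * e W = a" for W
    using that by (subst eta_eq)
      (simp add: convolution_diff_right convolution_sum_right convolution_basis flip: convolution_assoc)
  have "(\<Sum>Y\<in>{Y \<in> \<Lambda>. Y \<subset> X}. ?\<delta> a \<star> ?\<eta> Y) = (\<Sum>Y\<in>insert Z {Y \<in> \<Lambda>. Y \<subset> Z}. ?\<delta> a \<star> ?\<eta> Y)"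
  proof (rule sum.mono_neutral_right)
    show "insert Z {Y \<in> \<Lambda>. Y \<subset> Z} \<subseteq> {Y \<in> \<Lambda>. Y \<subset> X}" using Z ZX by auto
    show "\<forall>Y\<in>{Y \<in> \<Lambda>. Y \<subset> X} - insert Z {Y \<in> \<Lambda>. Y \<subset> Z}. ?\<delta> a \<star> ?\<eta> Y = 0"
    proof
      fix Y assume "Y \<in> {Y \<in> \<Lambda>. Y \<subset> X} - insert Z {Y \<in> \<Lambda>. Y \<subset> Z}"
      then show "?\<delta> a \<star> ?\<eta> Y = 0" using a by (intro psubset.IH) (auto simp: Z_def)
    qed
  qed simp
  also have "\<dots> = ?\<delta> a \<star> ?\<eta> Z + (\<Sum>Y\<in>{Y \<in> \<Lambda>. Y \<subset> Z}. ?\<delta> a \<star> ?\<eta> Y)"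
    by (rule sum.insert) auto
  also have "\<dots> = ?\<delta> a" unfolding recursion[OF aZ] by simp
  finally have "?\<delta> a \<star> ?\<eta> X = 0" unfolding recursion[OF aX] by simp
  moreover have "?\<delta> b \<star> ?\<eta> X = ?\<delta> a \<star> ?\<eta> X"
    unfolding a_def by (subst basis_eta[OF X, symmetric]) (simp add: convolution_basis flip: convolution_assoc)
  ultimately show ?case by simp
qed

text \<open>By induction on \<open>X\<close>, only the leading term \<open>e\<^sub>X\<close> of \<open>\<eta>\<^sub>X\<close> can contribute. Left duo monoids allow it to be
  moved past a monoid element, \<open>e\<^sub>X m = m' e\<^sub>X\<close>, and then it annihilates \<open>\<eta>\<^sub>Y\<close>.\<close>

lemma eta_sandwich_zero:
  fixes x :: "'m \<Rightarrow> 'k::field"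
  assumes X: "X \<in> \<Lambda>" and Y: "Y \<in> \<Lambda>" and "\<not> Y \<subseteq> X"
  shows "eta e X \<star> x \<star> eta e Y = 0"
  using finite[of X] X \<open>\<not> Y \<subseteq> X\<close>
proof (induction X arbitrary: x rule: finite_psubset_induct)
  case (psubset X)
  let ?\<delta> = "basis_element :: 'm \<Rightarrow> 'm \<Rightarrow> 'k" and ?\<eta> = "eta e :: 'm set \<Rightarrow> 'm \<Rightarrow> 'k"
  have eX: "?\<delta> (e X) \<star> ?\<eta> Y = 0"
    using psubset.prems transversal[OF psubset.prems(1)] by (intro idempotent_eta_zero Y) auto
  show ?case
  proof (induction x rule: linear_induct_UNIV)
    case (basis m)
    have "?\<eta> X \<star> ?\<delta> m \<star> ?\<eta> Y = ?\<delta> (e X) \<star> ?\<delta> m \<star> ?\<eta> Y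
        - (\<Sum>Z\<in>{Z \<in> \<Lambda>. Z \<subset> X}. ?\<delta> (e X) \<star> (?\<eta> Z \<star> ?\<delta> m \<star> ?\<eta> Y))"
      by (subst eta_eq) (simp add: convolution_diff_left convolution_sum_left convolution_assoc)
    also have "(\<Sum>Z\<in>{Z \<in> \<Lambda>. Z \<subset> X}. ?\<delta> (e X) \<star> (?\<eta> Z \<star> ?\<delta> m \<star> ?\<eta> Y)) = 0"
    proof (rule sum.neutral, rule ballI)
      fix Z assume "Z \<in> {Z \<in> \<Lambda>. Z \<subset> X}"
      then have "?\<eta> Z \<star> ?\<delta> m \<star> ?\<eta> Y = 0" using psubset.prems by (intro psubset.IH) auto
      then show "?\<delta> (e X) \<star> (?\<eta> Z \<star> ?\<delta> m \<star> ?\<eta> Y) = 0" by simp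
    qed
    also have "?\<delta> (e X) \<star> ?\<delta> m \<star> ?\<eta> Y = 0"
    proof -
      obtain m' where m': "e X * m = m' * e X" by (rule left_duo_swap)
      have "?\<delta> (e X) \<star> ?\<delta> m \<star> ?\<eta> Y = ?\<delta> m' \<star> (?\<delta> (e X) \<star> ?\<eta> Y)"
        by (simp add: convolution_basis m' flip: convolution_assoc)
      then show ?thesis unfolding eX by simp
    qed
    finally show ?case by simp
  qed (simp_all add: convolution_add_left convolution_add_right convolution_scale_left
      convolution_scale_right)
qed

lemma eta_mult_zero:
  assumes "X \<in> \<Lambda>" "Y \<in> \<Lambda>" "\<not> Y \<subseteq> X"
  shows "eta e X \<star> eta e Y = (0 :: 'm \<Rightarrow> 'k::field)"
  using eta_sandwich_zero[OF assms, of "basis_element 1 :: 'm \<Rightarrow> 'k"] by (simp add: convolution_one)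

text \<open>The lower terms of the first \<open>\<eta>\<^sub>X\<close> annihilate \<open>x \<eta>\<^sub>X\<close>.\<close>

lemma eta_sandwich:
  fixes x :: "'m \<Rightarrow> 'k::field"
  assumes X: "X \<in> \<Lambda>"
  shows "eta e X \<star> x \<star> eta e X = basis_element (e X) \<star> x \<star> eta e X"
proof -
  let ?\<delta> = "basis_element :: 'm \<Rightarrow> 'm \<Rightarrow> 'k" and ?\<eta> = "eta e :: 'm set \<Rightarrow> 'm \<Rightarrow> 'k"
  have "?\<eta> X \<star> x \<star> ?\<eta> X = ?\<delta> (e X) \<star> x \<star> ?\<eta> X
      - (\<Sum>Z\<in>{Z \<in> \<Lambda>. Z \<subset> X}. ?\<delta> (e X) \<star> (?\<eta> Z \<star> x \<star> ?\<eta> X))"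
    by (subst (1) eta_eq) (simp add: convolution_diff_left convolution_sum_left convolution_assoc)
  also have "(\<Sum>Z\<in>{Z \<in> \<Lambda>. Z \<subset> X}. ?\<delta> (e X) \<star> (?\<eta> Z \<star> x \<star> ?\<eta> X)) = 0"
  proof (rule sum.neutral, rule ballI)
    fix Z assume "Z \<in> {Z \<in> \<Lambda>. Z \<subset> X}"
    then have "?\<eta> Z \<star> x \<star> ?\<eta> X = 0" by (intro eta_sandwich_zero X) auto
    then show "?\<delta> (e X) \<star> (?\<eta> Z \<star> x \<star> ?\<eta> X) = 0" by simp
  qed
  finally show ?thesis by simp
qed

lemma eta_idempotent: "X \<in> \<Lambda> \<Longrightarrow> eta e X \<star> eta e X = (eta e X :: 'm \<Rightarrow> 'k::field)"
  using eta_sandwich[of X "basis_element 1 :: 'm \<Rightarrow> 'k"] by (simp add: convolution_one basis_eta)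

text \<open>For \<open>Y \<subset> X\<close> all terms \<open>e\<^sub>X \<eta>\<^sub>Z \<eta>\<^sub>Y\<close> of the recursion for \<open>\<eta>\<^sub>X\<close> vanish except the one with \<open>Z = Y\<close>,
  which is \<open>e\<^sub>X \<eta>\<^sub>Y\<close> and cancels the leading term.\<close>

lemma eta_orthogonal:
  assumes X: "X \<in> \<Lambda>" and Y: "Y \<in> \<Lambda>" and XY: "X \<noteq> Y"
  shows "eta e X \<star> eta e Y = (0 :: 'm \<Rightarrow> 'k::field)"
proof (cases "Y \<subset> X")
  case False
  then show ?thesis using XY by (intro eta_mult_zero X Y) auto
next
  case True
  let ?\<delta> = "basis_element :: 'm \<Rightarrow> 'm \<Rightarrow> 'k" and ?\<eta> = "eta e :: 'm set \<Rightarrow> 'm \<Rightarrow> 'k"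
  show ?thesis
    using finite[of X] X True
  proof (induction X rule: finite_psubset_induct)
    case (psubset X)
    have "?\<eta> Z \<star> ?\<eta> Y = 0" if "Z \<in> \<Lambda>" "Z \<subset> X" "Z \<noteq> Y" for Z
    proof (cases "Y \<subset> Z")
      case True
      then show ?thesis using that by (intro psubset.IH)
    next
      case False
      then show ?thesis using that by (intro eta_mult_zero Y) auto
    qed
    then have "(\<Sum>Z\<in>{Z \<in> \<Lambda>. Z \<subset> X}. ?\<delta> (e X) \<star> (?\<eta> Z \<star> ?\<eta> Y)) =
        (\<Sum>Z\<in>{Y}. ?\<delta> (e X) \<star> (?\<eta> Z \<star> ?\<eta> Y))"
      using psubset.prems Y by (intro sum.mono_neutral_right) auto
    also have "\<dots> = ?\<delta> (e X) \<star> ?\<eta> Y" by (simp add: eta_idempotent Y)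
    finally have lower: "(\<Sum>Z\<in>{Z \<in> \<Lambda>. Z \<subset> X}. ?\<delta> (e X) \<star> (?\<eta> Z \<star> ?\<eta> Y)) = ?\<delta> (e X) \<star> ?\<eta> Y" .
    have "?\<eta> X \<star> ?\<eta> Y = ?\<delta> (e X) \<star> ?\<eta> Y
        - (\<Sum>Z\<in>{Z \<in> \<Lambda>. Z \<subset> X}. ?\<delta> (e X) \<star> (?\<eta> Z \<star> ?\<eta> Y))"
      by (subst (1) eta_eq) (simp add: convolution_diff_left convolution_sum_left convolution_assoc)
    then show ?case unfolding lower by simp
  qed
qed

text \<open>This is the recursion at the largest left ideal, whose representative must be \<open>1\<close>.\<close>

lemma sum_eta: "(\<Sum>X\<in>\<Lambda>. eta e X) = (basis_element 1 :: 'm \<Rightarrow> 'k::field)"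
proof -
  have one: "(1 :: 'm) \<in> idempotents" by (simp add: idempotents_def)
  define T where "T = principal_left (1 :: 'm)"
  have T: "T \<in> \<Lambda>" unfolding T_def by (rule principal_left_in_poset[OF one])
  have "e T = 1"
  proof -
    have "1 * e T = 1" using principal_subset_iff[OF T one] by (simp add: T_def)
    then show ?thesis by simp
  qed
  have top: "Y \<subseteq> T" if "Y \<in> \<Lambda>" for Y using subset_iff_e[OF that T] \<open>e T = 1\<close> by simp
  then have "\<Lambda> = insert T {Y \<in> \<Lambda>. Y \<subset> T}" using T by auto
  then have "(\<Sum>X\<in>\<Lambda>. eta e X) = (eta e T + (\<Sum>Y\<in>{Y \<in> \<Lambda>. Y \<subset> T}. eta e Y) :: 'm \<Rightarrow> 'k)"
    using sum.insert[of "{Y \<in> \<Lambda>. Y \<subset> T}" T "eta e :: _ \<Rightarrow> 'm \<Rightarrow> 'k"] by simp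
  also have "\<dots> = basis_element 1"
    by (subst eta_eq) (simp add: \<open>e T = 1\<close> convolution_one)
  finally show ?thesis .
qed

text \<open>A product \<open>e\<^sub>X m\<close> that is not a unit in the corner at \<open>e\<^sub>X\<close> is a unit in a corner at an idempotent
  strictly below, and such an idempotent annihilates \<open>\<eta>\<^sub>X\<close>.\<close>

lemma eta_sandwich_projection:
  fixes x :: "'m \<Rightarrow> 'k::field"
  assumes X: "X \<in> \<Lambda>"
  shows "eta e X \<star> x \<star> eta e X = corner_projection (e X) x \<star> eta e X"
  unfolding eta_sandwich[OF X]
proof (induction x rule: linear_induct_UNIV)
  case (basis m)
  let ?\<delta> = "basis_element :: 'm \<Rightarrow> 'm \<Rightarrow> 'k" and ?\<eta> = "eta e :: 'm set \<Rightarrow> 'm \<Rightarrow> 'k"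
  let ?n = "e X * m"
  show ?case
  proof (cases "?n \<in> corner_units (e X)")
    case True
    then show ?thesis by (simp add: corner_projection_basis convolution_basis)
  next
    case False
    obtain f where f: "f \<in> idempotents" "?n \<in> corner_units f" by (rule in_corner_units)
    have ff: "f * f = f" using f(1) by (simp add: idempotents_def)
    obtain h where h: "?n * h = f" using f(2) by (auto simp: corner_units_def)
    have "\<not> X \<subseteq> principal_left f"
    proof
      assume "X \<subseteq> principal_left f"
      then have "e X * f = e X" using subset_principal_iff[OF X f(1)] by simp
      moreover have "e X * f = f" using e_idem(1)[OF X] by (simp flip: h mult.assoc)
      ultimately have "f = e X" by simp
      then show False using f(2) False by simp
    qed
    then have "?\<delta> f \<star> ?\<eta> X = 0" by (intro idempotent_eta_zero X f(1))
    moreover have "?\<delta> ?n \<star> ?\<eta> X = ?\<delta> ?n \<star> (?\<delta> f \<star> ?\<eta> X)"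
      using corner_unitsD(3)[OF ff f(2)] by (simp add: convolution_basis flip: convolution_assoc)
    ultimately have "?\<delta> ?n \<star> ?\<eta> X = 0" by simp
    then show ?thesis using False by (simp add: corner_projection_basis convolution_basis)
  qed
qed (simp_all add: convolution_add_left convolution_add_right convolution_scale_left
      convolution_scale_right corner_projection_linear)

text \<open>For \<open>Y \<subset> X\<close> the idempotent \<open>e\<^sub>X e\<^sub>Y\<close> differs from \<open>e\<^sub>X\<close>, so it is not a unit and the map kills \<open>e\<^sub>Y\<close>, hence
  also \<open>\<eta>\<^sub>Y = e\<^sub>Y \<eta>\<^sub>Y\<close>.\<close>

lemma projection_eta:
  assumes X: "X \<in> \<Lambda>"
  shows "corner_projection (e X) (eta e X) = (basis_element (e X) :: 'm \<Rightarrow> 'k::field)"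
proof -
  let ?\<phi> = "corner_projection (e X) :: ('m \<Rightarrow> 'k) \<Rightarrow> 'm \<Rightarrow> 'k"
  note eX = e_idem(1)[OF X]
  have "?\<phi> (basis_element (e X) \<star> eta e Y) = 0" if Y: "Y \<in> \<Lambda>" "Y \<subset> X" for Y
  proof -
    have "e X * e Y \<notin> corner_units (e X)"
    proof
      assume u: "e X * e Y \<in> corner_units (e X)"
      have "e X * e Y \<in> idempotents" using X Y(1) by (intro idempotents_mult_closed e_idem)
      then have "e X * e Y = e X" using u by (intro corner_units_idempotent[OF eX]) (simp_all add: idempotents_def)
      then show False using subset_iff_e[OF X Y(1)] Y(2) by auto
    qed
    then have "?\<phi> (basis_element (e Y)) = 0" by (simp add: corner_projection_basis)
    then have "?\<phi> (basis_element (e Y) \<star> eta e Y) = 0" by (simp add: corner_projection_mult[OF eX])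
    then show ?thesis by (simp add: basis_eta Y(1) corner_projection_mult[OF eX])
  qed
  then show ?thesis
    by (subst eta_eq) (simp add: corner_projection_diff corner_projection_sum corner_projection_basis
        eX corner_units_one[OF eX])
qed

lemma corner_retraction_eta:
  assumes X: "X \<in> \<Lambda>"
  shows "corner_retraction (monoid_algebra :: ('m \<Rightarrow> 'k::field) ring) (group_algebra_at (e X))
    (corner_projection (e X)) (eta e X)"
proof -
  note eX = e_idem(1)[OF X]
  show ?thesis
  proof (intro corner_retraction.intro corner_retraction_axioms.intro ring_monoid_algebra ring_group_algebra eX)
    show "corner_projection (e X) \<in> ring_hom (monoid_algebra :: ('m \<Rightarrow> 'k) ring) (group_algebra_at (e X))"
      by (rule ring_hom_memI)
        (simp_all only: corner_projection_closed corner_projection_mult[OF eX] corner_projection_linear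
          monoid_algebra_simps group_algebra_simps(2-5) corner_projection_basis mult_1_right eX
          corner_units_one[OF eX] if_True)
  qed (simp_all add: monoid_algebra_simps group_algebra_simps(2-5) corner_projection_retract[OF eX]
      projection_eta[OF X] basis_eta[OF X] eta_sandwich_projection[OF X])
qed

end

section \<open>Primitive idempotents and projective covers\<close>

theorem theorem2p10:
  fixes e :: "'m::{finite, monoid_mult} set \<Rightarrow> 'm"
    and k :: "'m set \<Rightarrow> nat"
    and \<theta> :: "'m set \<Rightarrow> nat \<Rightarrow> 'm \<Rightarrow> 'k::field"
    and \<gamma> :: "'m set \<Rightarrow> nat \<Rightarrow> 'm \<Rightarrow> 'k"
  assumes regular: "regular_monoid TYPE('m)"
    and left_duo: "left_duo_monoid TYPE('m)"
    and e: "\<And>L. L \<in> left_ideal_poset \<Longrightarrow> e L \<in> idempotents \<and> L = principal_left (e L)"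
    and \<theta>: "\<And>L. L \<in> left_ideal_poset \<Longrightarrow>
          complete_orthogonal_primitive (group_algebra_at (e L)) {1..k L} (\<theta> L)"
    and \<gamma>: "\<And>L i. \<gamma> L i =
          eta e L \<otimes>\<^bsub>monoid_algebra\<^esub> \<theta> L i \<otimes>\<^bsub>monoid_algebra\<^esub> eta e L"
  shows "complete_orthogonal_primitive monoid_algebra
           (SIGMA L:left_ideal_poset. {1..k L}) (\<lambda>(L, i). \<gamma> L i) \<and>
         (\<forall>L\<in>left_ideal_poset. \<forall>i\<in>{1..k L}.
            let KM = monoid_algebra :: ('m \<Rightarrow> 'k) ring;
                KG = group_algebra_at (e L) :: ('m \<Rightarrow> 'k) ring;
                S = quotient_module
                      (left_ideal_module KG (right_translate KG (carrier KG) (\<theta> L i)))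
                      (right_translate KG (jacobson_radical KG) (\<theta> L i))
            in simple_module KG S \<and>
               (\<exists>\<pi>. projective_cover TYPE('a) TYPE('b) KM
                  (left_ideal_module KM (right_translate KM (carrier KM) (\<gamma> L i)))
                  (restrict_scalars (corner_projection (e L)) S) \<pi>))"
proof -
  interpret transversal "TYPE('m)" e
    by unfold_locales (use regular left_duo e in auto)
  let ?KM = "monoid_algebra :: ('m \<Rightarrow> 'k) ring"
  let ?KG = "\<lambda>L. group_algebra_at (e L) :: ('m \<Rightarrow> 'k) ring"
  have prim: "primitive_idempotent (?KG L) (\<theta> L i)" if "L \<in> \<Lambda>" "i \<in> {1..k L}" for L i
    using \<theta>[OF that(1)] that(2) by (auto simp: complete_orthogonal_primitive_def)
  have idem: "idempotent_element (?KG L) (\<theta> L i)" if "L \<in> \<Lambda>" "i \<in> {1..k L}" for L i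
    using prim[OF that] by (simp add: primitive_idempotent_def)
  have closed: "\<theta> L i \<in> carrier (?KG L)" if "L \<in> \<Lambda>" "i \<in> {1..k L}" for L i
    using idem[OF that] by (simp add: idempotent_element_def)
  have lift: "\<gamma> L i = \<theta> L i \<star> eta e L" if "L \<in> \<Lambda>" "i \<in> {1..k L}" for L i
    using corner_retraction.lift_eq[OF corner_retraction_eta[OF that(1)] closed[OF that]]
    by (simp add: \<gamma> monoid_algebra_simps)
  have \<gamma>': "\<gamma> L i = eta e L \<star> \<theta> L i \<star> eta e L" for L i
    by (simp add: \<gamma> monoid_algebra_simps)
  have sum_\<theta>: "(\<Sum>i\<in>{1..k L}. \<theta> L i) = basis_element (e L)" if L: "L \<in> \<Lambda>" for L
  proof -
    interpret KG: ring "?KG L" by (rule ring_group_algebra[OF e_idem(1)[OF L]])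
    have "finsum (?KG L) (\<theta> L) {1..k L} = (\<Sum>i\<in>{1..k L}. \<theta> L i)"
      by (rule finsum_pointwise) (use closed[OF L] KG.abelian_monoid_axioms in \<open>auto simp: group_algebra_simps(4,5)\<close>)
    then show ?thesis
      using \<theta>[OF L] by (simp add: complete_orthogonal_primitive_def group_algebra_simps(3))
  qed
  interpret KM: ring ?KM by (rule ring_monoid_algebra)
  have "complete_orthogonal_primitive ?KM (SIGMA L:\<Lambda>. {1..k L}) (\<lambda>(L, i). \<gamma> L i)"
    unfolding complete_orthogonal_primitive_def
  proof (intro conjI ballI impI)
    show "finite (SIGMA L:\<Lambda>. {1..k L})" by simp
    show "primitive_idempotent ?KM (case p of (L, i) \<Rightarrow> \<gamma> L i)" if pS: "p \<in> (SIGMA L:\<Lambda>. {1..k L})" for p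
    proof -
      obtain L i where p: "p = (L, i)" "L \<in> \<Lambda>" "i \<in> {1..k L}" using pS by (elim SigmaE)
      show ?thesis
        using corner_retraction.primitive_idempotent_lift[OF corner_retraction_eta[OF p(2)] prim[OF p(2,3)]]
        by (simp add: p(1) lift[OF p(2,3)] monoid_algebra_simps)
    qed
    have product: "\<gamma> L i \<star> \<gamma> L' i' = 0"
      if "L \<in> \<Lambda>" "i \<in> {1..k L}" "L' \<in> \<Lambda>" "i' \<in> {1..k L'}" "(L, i) \<noteq> (L', i')" for L i L' i'
    proof (cases "L = L'")
      case True
      then have "\<theta> L i \<star> \<theta> L i' = 0"
        using \<theta>[OF that(1)] that
        by (auto simp: complete_orthogonal_primitive_def orthogonal_elements_def group_algebra_simps(2,4))
      moreover have "\<gamma> L i \<star> \<gamma> L i' = (\<theta> L i \<star> \<theta> L i') \<star> eta e L"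
        using corner_retraction.lift_mult[OF corner_retraction_eta[OF that(1)], of "\<theta> L i" "\<theta> L i'"]
          closed that True
        by (simp add: lift monoid_algebra_simps)
      ultimately show ?thesis using True by simp
    next
      case False
      have "\<gamma> L i \<star> \<gamma> L' i' =
          eta e L \<star> \<theta> L i \<star> (eta e L \<star> eta e L') \<star> \<theta> L' i' \<star> eta e L'"
        by (simp add: \<gamma>' convolution_assoc)
      then show ?thesis by (simp add: eta_orthogonal that(1,3) False)
    qed
    show "orthogonal_elements ?KM (case p of (L, i) \<Rightarrow> \<gamma> L i) (case q of (L, i) \<Rightarrow> \<gamma> L i)"
      if pq: "p \<in> (SIGMA L:\<Lambda>. {1..k L})" "q \<in> (SIGMA L:\<Lambda>. {1..k L})" "p \<noteq> q" for p q
    proof -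
      obtain L i L' i' where *: "p = (L, i)" "L \<in> \<Lambda>" "i \<in> {1..k L}" "q = (L', i')" "L' \<in> \<Lambda>" "i' \<in> {1..k L'}"
        using pq(1,2) by (elim SigmaE)
      then have "\<gamma> L i \<star> \<gamma> L' i' = 0" "\<gamma> L' i' \<star> \<gamma> L i = 0"
        using product[OF *(2,3,5,6)] product[OF *(5,6,2,3)] pq(3) by auto
      then show ?thesis by (simp add: *(1,4) orthogonal_elements_def monoid_algebra_simps)
    qed
    have "finsum ?KM (\<lambda>(L, i). \<gamma> L i) (SIGMA L:\<Lambda>. {1..k L}) = (\<Sum>(L, i)\<in>(SIGMA L:\<Lambda>. {1..k L}). \<gamma> L i)"
      by (rule finsum_pointwise) (auto simp: monoid_algebra_simps KM.abelian_monoid_axioms)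
    also have "\<dots> = (\<Sum>L\<in>\<Lambda>. \<Sum>i\<in>{1..k L}. \<gamma> L i)" by (rule sum.Sigma[symmetric]) auto
    also have "\<dots> = (\<Sum>L\<in>\<Lambda>. (\<Sum>i\<in>{1..k L}. \<theta> L i) \<star> eta e L)"
      by (simp add: lift convolution_sum_left)
    also have "\<dots> = (\<Sum>L\<in>\<Lambda>. eta e L)" by (intro sum.cong refl) (simp only: sum_\<theta> basis_eta)
    also have "\<dots> = \<one>\<^bsub>?KM\<^esub>" by (simp add: sum_eta monoid_algebra_simps)
    finally show "finsum ?KM (\<lambda>(L, i). \<gamma> L i) (SIGMA L:\<Lambda>. {1..k L}) = \<one>\<^bsub>?KM\<^esub>" .
  qed
  moreover have "simple_module (?KG L) (quotient_module
      (left_ideal_module (?KG L) (right_translate (?KG L) (carrier (?KG L)) (\<theta> L i)))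
      (right_translate (?KG L) (jacobson_radical (?KG L)) (\<theta> L i)))"
    if "L \<in> \<Lambda>" "i \<in> {1..k L}" for L i
    by (intro ring.simple_module_top ring_group_algebra strongly_pi_regular_group_algebra
        e_idem(1) prim that)
  moreover have "\<exists>\<pi>. projective_cover TYPE('a) TYPE('b) ?KM
      (left_ideal_module ?KM (right_translate ?KM (carrier ?KM) (\<gamma> L i)))
      (restrict_scalars (corner_projection (e L)) (quotient_module
        (left_ideal_module (?KG L) (right_translate (?KG L) (carrier (?KG L)) (\<theta> L i)))
        (right_translate (?KG L) (jacobson_radical (?KG L)) (\<theta> L i)))) \<pi>"
    if "L \<in> \<Lambda>" "i \<in> {1..k L}" for L i
    using corner_retraction.projective_cover_lift[OF corner_retraction_eta[OF that(1)] idem[OF that]]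
    unfolding lift[OF that] by (simp add: monoid_algebra_simps(2))
  ultimately show ?thesis unfolding Let_def by blast
qed

end
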